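(* Let $\alpha,\beta>-1$. The Lebesgue constant of $L_n^{\alpha,\beta}f$ satisfies, as $n\to\infty$, $$\|L_n^{\alpha,\beta}\|_\infty=\mathcal{O}(1)\begin{cases}n^{2\max\{\alpha,\beta\}+1},&\max\{\alpha,\beta\}>-1/2,\\ \log^2n,&\max\{\alpha,\beta\}\le-1/2.\end{cases}$$
   Context: Let $\Omega=\{(u,v):1+u+v>0,\ 1-u+v>0,\ u^2>4v\}$ and let $W_{\alpha,\beta,-1/2}(u,v)$ be the weight proportional to $(1-u+v)^\alpha(1+u+v)^\beta(u^2-4v)^{-1/2}$ on $\Omega$. Let $x_{1,n},\dots,x_{n,n}$ be the zeros of the Jacobi polynomial $P_n^{(\alpha,\beta)}$ (orthogonal on $[-1,1]$ with respect to $(1-x)^\alpha(1+x)^\beta$). The nodes of the Gaussian cubature rule of degree $2n-1$ for $W_{\alpha,\beta,-1/2}$ are the $n(n+1)/2$ points $(x_{j,n}+x_{k,n},\,x_{j,n}x_{k,n})$, $1\le j\le k\le n$. $L_n^{\alpha,\beta}f$ is the unique polynomial in two variables of total degree at most $n-1$ that agrees with $f$ at these nodes. The Lebesgue constant $\|L_n^{\alpha,\beta}\|_\infty$ is the operator norm of $f\mapsto L_n^{\alpha,\beta}f$ on $C(\overline{\Omega})$ with the uniform norm. The constant in $\mathcal{O}(1)$ may depend on $\alpha,\beta$ but not on $n$.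
   Formalization: Ω is restricted by −2<u<2 to the bounded region {(x+y,xy): −1<x<y<1}; the three inequalities alone also admit unbounded pieces, e.g. (3, 2.1), where the interpolating polynomials are unbounded and the operator norm is infinite. *)

theory Defs
  imports "HOL-Analysis.Analysis" "HOL-Computational_Algebra.Polynomial"
    "HOL-Library.Landau_Symbols"
begin

text \<open>The inequalities \<open>1 + u + v > 0\<close>, \<open>1 - u + v > 0\<close>, \<open>u\<^sup>2 > 4 v\<close> alone also cut out two unbounded
  pieces, in \<open>u > 2\<close> and in \<open>u < - 2\<close>. The domain meant is the bounded region enclosed by the two
  lines and the parabola, that is, the image of the open triangle \<open>- 1 < x < y < 1\<close> under
  \<open>(x, y) \<mapsto> (x + y, x y)\<close>; the conditions on \<open>u\<close> select it (see \<open>Omega_eq_image\<close>).\<close>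

definition Omega :: "(real \<times> real) set" where
  "Omega = {(u, v). 1 + u + v > 0 \<and> 1 - u + v > 0 \<and> u\<^sup>2 > 4 * v \<and> - 2 < u \<and> u < 2}"

lemma Omega_eq_image:
  "Omega = {(x + y, x * y) | x y. - 1 < x \<and> x < y \<and> y < 1}"
proof (intro equalityI subsetI)
  fix z assume "z \<in> Omega"
  then obtain u v where z: "z = (u, v)" and h: "1 + u + v > 0" "1 - u + v > 0" "u\<^sup>2 > 4 * v"
    "- 2 < u" "u < 2"
    by (auto simp: Omega_def)
  define s where "s = sqrt (u\<^sup>2 - 4 * v)"
  have s: "s > 0" "s\<^sup>2 = u\<^sup>2 - 4 * v"
    using h by (auto simp: s_def)
  have "s < 2 - u"
    by (rule power2_less_imp_less) (use s h in \<open>auto simp: power2_eq_square algebra_simps\<close>)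
  moreover have "s < 2 + u"
    by (rule power2_less_imp_less) (use s h in \<open>auto simp: power2_eq_square algebra_simps\<close>)
  moreover have "(u - s) / 2 * ((u + s) / 2) = v"
    using s by (simp add: power2_eq_square field_simps)
  ultimately show "z \<in> {(x + y, x * y) | x y. - 1 < x \<and> x < y \<and> y < 1}"
    using s z by (intro CollectI exI[of _ "(u - s) / 2"] exI[of _ "(u + s) / 2"])
      (auto simp: field_simps)
next
  fix z :: "real \<times> real" assume "z \<in> {(x + y, x * y) | x y. - 1 < x \<and> x < y \<and> y < 1}"
  then obtain x y where z: "z = (x + y, x * y)" and h: "- 1 < x" "x < y" "y < 1"
    by auto
  have "(1 + x) * (1 + y) > 0" "(1 - x) * (1 - y) > 0" "(x - y)\<^sup>2 > 0"
    using h by auto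
  then show "z \<in> Omega"
    using z h by (simp add: Omega_def power2_eq_square algebra_simps)
qed

text \<open>Orthogonality determines the Jacobi polynomial up to a factor, which is fixed by the usual
  normalization \<open>P\<^sub>n(1) = (n + \<alpha> choose n)\<close>; its zeros do not depend on this choice.\<close>

definition jacobi_poly :: "real \<Rightarrow> real \<Rightarrow> nat \<Rightarrow> real poly" where
  "jacobi_poly \<alpha> \<beta> n = (THE p. degree p = n \<and>
     (\<forall>q. degree q < n \<longrightarrow>
        (LINT x:{-1..1}|lborel. poly p x * poly q x * ((1 - x) powr \<alpha> * (1 + x) powr \<beta>)) = 0) \<and>
     poly p 1 = (real n + \<alpha>) gchoose n)"

definition jacobi_zeros :: "real \<Rightarrow> real \<Rightarrow> nat \<Rightarrow> real set" where
  "jacobi_zeros \<alpha> \<beta> n = {x. poly (jacobi_poly \<alpha> \<beta> n) x = 0}"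

text \<open>The zeros being simple, pairs of indices \<open>j \<le> k\<close> are the same as ordered pairs of zeros
  \<open>x \<le> y\<close>.\<close>

definition cubature_nodes :: "real \<Rightarrow> real \<Rightarrow> nat \<Rightarrow> (real \<times> real) set" where
  "cubature_nodes \<alpha> \<beta> n =
     {(x + y, x * y) | x y. x \<in> jacobi_zeros \<alpha> \<beta> n \<and> y \<in> jacobi_zeros \<alpha> \<beta> n \<and> x \<le> y}"

text \<open>Real polynomials in two variables of total degree at most \<open>d\<close>, as functions on the plane.\<close>

definition polys2 :: "nat \<Rightarrow> (real \<times> real \<Rightarrow> real) set" where
  "polys2 d = {p. \<exists>c :: nat \<Rightarrow> nat \<Rightarrow> real.
     p = (\<lambda>(u, v). \<Sum>(i, j)\<in>{(i, j). i + j \<le> d}. c i j * u ^ i * v ^ j)}"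

definition interp :: "real \<Rightarrow> real \<Rightarrow> nat \<Rightarrow> (real \<times> real \<Rightarrow> real) \<Rightarrow> (real \<times> real \<Rightarrow> real)" where
  "interp \<alpha> \<beta> n f = (THE p. p \<in> polys2 (n - 1) \<and> (\<forall>z\<in>cubature_nodes \<alpha> \<beta> n. p z = f z))"

definition unif_norm :: "(real \<times> real \<Rightarrow> real) \<Rightarrow> real" where
  "unif_norm f = (SUP z\<in>closure Omega. \<bar>f z\<bar>)"

text \<open>The operator norm on \<open>C(closure Omega)\<close>, written as in the library's \<^const>\<open>onorm\<close>, which is
  tied to a type and so cannot be used for this function space. The function \<open>f = 0\<close> contributes
  \<open>0 / 0 = 0\<close>.\<close>

definition lebesgue_constant :: "real \<Rightarrow> real \<Rightarrow> nat \<Rightarrow> real" where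
  "lebesgue_constant \<alpha> \<beta> n =
     (SUP f\<in>{f. continuous_on (closure Omega) f}. unif_norm (interp \<alpha> \<beta> n f) / unif_norm f)"

end

theory Submission
  imports Defs
begin

text \<open>
  In the coordinates \<open>u = x + y\<close>, \<open>v = x y\<close> a polynomial of total degree at most \<open>n - 1\<close> in \<open>(u, v)\<close>
  is a symmetric polynomial of degree at most \<open>n - 1\<close> in each of \<open>x\<close> and \<open>y\<close>, and conversely. The nodes
  are the pairs of Jacobi zeros, so the interpolant of \<open>f\<close> is the tensor product Lagrange interpolant
  of \<open>(x, y) \<mapsto> f (x + y, x y)\<close> (\<open>interp_eq_tensor\<close>), and the Lebesgue constant is at most the square
  of the univariate one (\<open>lebesgue_constant_bound\<close>). What has to be shown is that
  \<open>\<Sum>\<^sub>r \<bar>l\<^sub>r x\<bar>\<close>, the sum over the zeros \<open>r\<close> of \<open>P = P\<^sub>n\<close>, is \<open>O(n powr \<gamma>)\<close> on \<open>[-1, 1]\<close> with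
  \<open>\<gamma> = max \<alpha> \<beta> + 1/2\<close> if this is positive, and \<open>O(ln n)\<close> otherwise
  (\<open>jacobi_lebesgue_function_bound\<close>).

  This is proved without asymptotic formulas for \<open>P\<close>, by an energy argument. The function
  \<open>U t = sin (t/2) powr (\<alpha> + 1/2) * cos (t/2) powr (\<beta> + 1/2) * P (cos t)\<close> satisfies
  \<open>U'' = - (N\<^sup>2 + g) U\<close> with \<open>N = n + (\<alpha> + \<beta> + 1)/2\<close> and \<open>g = O(1 / sin\<^sup>2 t)\<close> (\<open>trig_weight_ode\<close>). On
  \<open>[c/N, \<pi> - c/N]\<close> the integral of \<open>\<bar>g\<bar> / N\<close> is bounded, hence by Gronwall's argument the energy
  \<open>U'\<^sup>2 + N\<^sup>2 U\<^sup>2\<close> is constant up to a bounded factor (\<open>energy_comparison\<close>). At a zero \<open>s\<close> of \<open>U\<close> the energy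
  is \<open>U'(s)\<^sup>2\<close>; so \<open>\<bar>U t\<bar>\<close> is at most a constant times \<open>\<bar>U' s\<bar> min (1/N) \<bar>t - s\<bar>\<close>, and distinct zeros
  are at least \<open>\<delta>/N\<close> apart (\<open>energy_consequences\<close>). Since
  \<open>l\<^sub>r (cos t) = P (cos t) / (P' r * (cos t - r))\<close> with \<open>r = cos s\<close>, the normalization of \<open>P\<close> cancels and
  elementary trigonometry gives \<open>\<bar>l\<^sub>r (cos t)\<bar> \<le> C (1 + N \<bar>t - s\<bar>) powr (\<gamma>' - 1)\<close> with
  \<open>\<gamma>' = max 0 (max \<alpha> \<beta> + 1/2)\<close> (\<open>lagrange_pointwise\<close>). Summing over separated points \<open>s\<close> yields the
  two growth rates (\<open>separated_sum_rate\<close>).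

  In the two remaining caps, of angular width \<open>c/N\<close>, the differential equation of \<open>P\<close> shows that \<open>P\<close> has
  no zero and varies by a factor of at most 3 (\<open>jacobi_op_endpoint\<close>). There the Lebesgue function is at
  most three times its value at the edge of the cap.
\<close>

section \<open>Integration of polynomials against the Jacobi weight\<close>

definition jacobi_weight :: "real \<Rightarrow> real \<Rightarrow> real \<Rightarrow> real" where
  "jacobi_weight \<alpha> \<beta> x = (1 - x) powr \<alpha> * (1 + x) powr \<beta>"

definition jacobi_int :: "real \<Rightarrow> real \<Rightarrow> real poly \<Rightarrow> real" where
  "jacobi_int \<alpha> \<beta> p = (LINT x:{-1..1}|lborel. poly p x * jacobi_weight \<alpha> \<beta> x)"

lemma jacobi_weight_pos: "x \<in> {-1<..<1} \<Longrightarrow> jacobi_weight \<alpha> \<beta> x > 0"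
  by (simp add: jacobi_weight_def)

lemma jacobi_weight_nonneg: "jacobi_weight \<alpha> \<beta> x \<ge> 0"
  by (simp add: jacobi_weight_def)

lemma jacobi_weight_integrable:
  assumes "\<alpha> > -1" "\<beta> > -1"
  shows "set_integrable lborel {-1..1} (jacobi_weight \<alpha> \<beta>)"
proof -
  have "set_integrable lborel {0..1} (\<lambda>t. t powr ((\<beta> + 1) - 1) * (1 - t) powr ((\<alpha> + 1) - 1))"
    using assms by (intro integrable_Beta) auto
  then have "integrable lborel (\<lambda>t. indicator {0..1} t *\<^sub>R (t powr \<beta> * (1 - t) powr \<alpha>) :: real)"
    by (simp add: set_integrable_def)
  from lborel_integrable_real_affine[OF this, of "1/2" "1/2"]
  have "integrable lborel (\<lambda>x. 2 powr (\<alpha> + \<beta>) * (indicator {0..1} (1/2 + 1/2 * x) *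
      ((1/2 + 1/2 * x) powr \<beta> * (1 - (1/2 + 1/2 * x)) powr \<alpha>)) :: real)"
    by (intro integrable_mult_right) simp
  also have "(\<lambda>x. 2 powr (\<alpha> + \<beta>) * (indicator {0..1} (1/2 + 1/2 * x) *
      ((1/2 + 1/2 * x) powr \<beta> * (1 - (1/2 + 1/2 * x)) powr \<alpha>)) :: real) =
      (\<lambda>x. indicator {-1..1} x *\<^sub>R jacobi_weight \<alpha> \<beta> x)"
  proof
    fix x :: real
    show "2 powr (\<alpha> + \<beta>) * (indicator {0..1} (1/2 + 1/2 * x) *
      ((1/2 + 1/2 * x) powr \<beta> * (1 - (1/2 + 1/2 * x)) powr \<alpha>)) =
       indicator {-1..1} x *\<^sub>R jacobi_weight \<alpha> \<beta> x"
    proof (cases "x \<in> {-1..1}")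
      case True
      have e: "1/2 + 1/2 * x = (1 + x) / 2" "1 - (1/2 + 1/2 * x) = (1 - x) / 2" by (auto simp: field_simps)
      have "(1/2 + 1/2 * x) powr \<beta> = (1 + x) powr \<beta> / 2 powr \<beta>"
        "(1 - (1/2 + 1/2 * x)) powr \<alpha> = (1 - x) powr \<alpha> / 2 powr \<alpha>"
        using True by (subst e, subst powr_divide; simp)+
      then show ?thesis using True by (simp add: jacobi_weight_def powr_add)
    next
      case False
      then have "1/2 + 1/2 * x \<notin> {0..1}" by auto
      then show ?thesis using False by simp
    qed
  qed
  finally show ?thesis by (simp add: set_integrable_def)
qed

lemma jacobi_int_integrable:
  assumes "\<alpha> > -1" "\<beta> > -1"
  shows "set_integrable lborel {-1..1} (\<lambda>x. poly p x * jacobi_weight \<alpha> \<beta> x)"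
proof -
  have "compact (poly p ` {-1..1})"
    by (intro compact_continuous_image continuous_intros) auto
  then obtain C where C: "\<And>x. x \<in> {-1..1} \<Longrightarrow> \<bar>poly p x\<bar> \<le> C"
    by (metis bounded_iff compact_imp_bounded imageI real_norm_def)
  have "set_integrable lborel {-1..1} (\<lambda>x. C * jacobi_weight \<alpha> \<beta> x)"
    using jacobi_weight_integrable[OF assms] by simp
  then show ?thesis
  proof (rule set_integrable_bound)
    show "set_borel_measurable lborel {-1..1} (\<lambda>x. poly p x * jacobi_weight \<alpha> \<beta> x)"
      unfolding set_borel_measurable_def jacobi_weight_def
      by measurable (auto intro!: borel_measurable_continuous_onI continuous_intros)
    show "AE x in lborel. x \<in> {-1..1} \<longrightarrow> norm (poly p x * jacobi_weight \<alpha> \<beta> x) \<le> norm (C * jacobi_weight \<alpha> \<beta> x)"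
    proof (intro AE_I2 impI)
      fix x :: real assume "x \<in> {-1..1}"
      then have "\<bar>poly p x\<bar> \<le> \<bar>C\<bar>" using C[of x] by linarith
      then show "norm (poly p x * jacobi_weight \<alpha> \<beta> x) \<le> norm (C * jacobi_weight \<alpha> \<beta> x)"
        by (simp add: abs_mult mult_right_mono)
    qed
  qed
qed

lemma jacobi_int_has_integral:
  assumes "\<alpha> > -1" "\<beta> > -1"
  shows "((\<lambda>x. poly p x * jacobi_weight \<alpha> \<beta> x) has_integral jacobi_int \<alpha> \<beta> p) {-1..1}"
  unfolding jacobi_int_def
  using set_borel_integral_eq_integral[OF jacobi_int_integrable[OF assms, of p]]
  by (metis integrable_integral)

lemma jacobi_int_add:
  assumes "\<alpha> > -1" "\<beta> > -1"
  shows "jacobi_int \<alpha> \<beta> (p + q) = jacobi_int \<alpha> \<beta> p + jacobi_int \<alpha> \<beta> q"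
  unfolding jacobi_int_def
  using set_integral_add(2)[OF jacobi_int_integrable[OF assms, of p] jacobi_int_integrable[OF assms, of q]]
  by (simp add: distrib_right)

lemma jacobi_int_smult: "jacobi_int \<alpha> \<beta> (smult c p) = c * jacobi_int \<alpha> \<beta> p"
  unfolding jacobi_int_def by (simp add: mult.assoc)

lemma jacobi_int_diff:
  assumes "\<alpha> > -1" "\<beta> > -1"
  shows "jacobi_int \<alpha> \<beta> (p - q) = jacobi_int \<alpha> \<beta> p - jacobi_int \<alpha> \<beta> q"
  using jacobi_int_add[OF assms, of p "smult (-1) q"] jacobi_int_smult[of \<alpha> \<beta> "-1" q] by simp

text \<open>Strict positivity is what turns orthogonality into information about zeros. In the proof, restricting
  to \<open>[-1/2, 1/2]\<close> avoids the possible singularities of the weight at the end points.\<close>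

lemma jacobi_int_pos:
  assumes ab: "\<alpha> > -1" "\<beta> > -1" and nn: "\<And>x. x \<in> {-1<..<1} \<Longrightarrow> poly p x \<ge> 0" and "p \<noteq> 0"
  shows "jacobi_int \<alpha> \<beta> p > 0"
proof (rule ccontr)
  assume "\<not> jacobi_int \<alpha> \<beta> p > 0"
  let ?f = "\<lambda>x. poly p x * jacobi_weight \<alpha> \<beta> x"
  have int: "?f integrable_on {-1..1}" "integral {-1..1} ?f = jacobi_int \<alpha> \<beta> p"
    using jacobi_int_has_integral[OF ab, of p] by (auto simp: has_integral_iff)
  have int2: "?f integrable_on {-1/2..1/2}"
    by (rule integrable_subinterval_real[OF int(1)]) auto
  have nn': "?f x \<ge> 0" if "x \<in> {-1..1}" for x
  proof -
    have "closure {-1<..<1::real} = {-1..1}" by simp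
    moreover have "closure {-1<..<1} \<subseteq> {x. poly p x \<ge> 0}"
      by (intro closure_minimal closed_Collect_le continuous_intros) (use nn in auto)
    ultimately show ?thesis using that jacobi_weight_nonneg[of \<alpha> \<beta> x] by auto
  qed
  have "integral {-1/2..1/2} ?f \<le> integral {-1..1} ?f"
    by (rule integral_subset_le) (use int int2 nn' in auto)
  moreover have "integral {-1/2..1/2} ?f \<ge> 0"
    by (rule integral_nonneg) (use int2 nn' in auto)
  ultimately have "integral {-1/2..1/2} ?f = 0"
    using \<open>\<not> jacobi_int \<alpha> \<beta> p > 0\<close> int(2) by simp
  moreover have "continuous_on {-1/2..1/2} ?f"
    unfolding jacobi_weight_def by (intro continuous_intros) auto
  ultimately have "\<forall>x\<in>{-1/2..1/2}. ?f x = 0"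
    using integral_eq_0_iff[of "-1/2" "1/2" ?f] nn' by auto
  have "{-1/2..1/2} \<subseteq> {x. poly p x = 0}"
  proof
    fix x :: real assume x: "x \<in> {-1/2..1/2}"
    then have "poly p x * jacobi_weight \<alpha> \<beta> x = 0" using \<open>\<forall>x\<in>{-1/2..1/2}. ?f x = 0\<close> by blast
    moreover have "jacobi_weight \<alpha> \<beta> x > 0" by (rule jacobi_weight_pos) (use x in auto)
    ultimately show "x \<in> {x. poly p x = 0}" by simp
  qed
  moreover have "infinite {-1/2..1/2::real}" by (simp add: infinite_Icc)
  ultimately show False
    using poly_roots_finite[OF \<open>p \<noteq> 0\<close>] finite_subset by blast
qed

section \<open>Jacobi polynomials as eigenfunctions\<close>

definition jacobi_orth :: "real \<Rightarrow> real \<Rightarrow> nat \<Rightarrow> real poly \<Rightarrow> bool" where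
  "jacobi_orth \<alpha> \<beta> n p \<longleftrightarrow> (\<forall>q. degree q < n \<longrightarrow> jacobi_int \<alpha> \<beta> (p * q) = 0)"

text \<open>The Jacobi differential operator; \<open>jacobi_flux_deriv\<close> gives its divergence form, in which it is
  \<open>1/w\<close> times the derivative of \<open>(1 - x\<^sup>2) w p'\<close> for the weight \<open>w\<close>.\<close>

definition jacobi_op :: "real \<Rightarrow> real \<Rightarrow> real poly \<Rightarrow> real poly" where
  "jacobi_op \<alpha> \<beta> p = [:1, 0, -1:] * pderiv (pderiv p) + [:\<beta> - \<alpha>, -(\<alpha> + \<beta> + 2):] * pderiv p"

lemma poly_jacobi_op: "poly (jacobi_op \<alpha> \<beta> p) x = (1 - x\<^sup>2) * poly (pderiv (pderiv p)) x +
    (\<beta> - \<alpha> - (\<alpha> + \<beta> + 2) * x) * poly (pderiv p) x"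
  by (simp add: jacobi_op_def algebra_simps power2_eq_square)

lemma jacobi_flux_deriv:
  assumes x: "x \<in> {-1<..<1}"
  shows "((\<lambda>x. jacobi_weight (\<alpha> + 1) (\<beta> + 1) x * poly (pderiv p) x) has_real_derivative
     jacobi_weight \<alpha> \<beta> x * poly (jacobi_op \<alpha> \<beta> p) x) (at x)"
proof -
  have e: "(1 - x) powr (\<alpha> + 1) = (1 - x) powr \<alpha> * (1 - x)" "(1 + x) powr (\<beta> + 1) = (1 + x) powr \<beta> * (1 + x)"
    using x by (auto simp: powr_add)
  have d1: "((\<lambda>x. (1 - x) powr (\<alpha> + 1)) has_real_derivative - ((\<alpha> + 1) * (1 - x) powr \<alpha>)) (at x)"
    using x
    by (auto intro!: derivative_eq_intros simp: powr_diff)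
  have d2: "((\<lambda>x. (1 + x) powr (\<beta> + 1)) has_real_derivative (\<beta> + 1) * (1 + x) powr \<beta>) (at x)"
    using x by (auto intro!: derivative_eq_intros simp: powr_diff)
  show ?thesis unfolding jacobi_weight_def
    by (rule DERIV_cong[OF DERIV_mult[OF DERIV_mult[OF d1 d2] poly_DERIV]])
      (simp only: e poly_jacobi_op, algebra)
qed

text \<open>Green's formula: the boundary terms carry the factor \<open>(1 - x) powr (\<alpha> + 1) * (1 + x) powr (\<beta> + 1)\<close>,
  which vanishes at both end points because \<open>\<alpha>, \<beta> > -1\<close>.\<close>

lemma jacobi_op_self_adjoint:
  assumes ab: "\<alpha> > -1" "\<beta> > -1"
  shows "jacobi_int \<alpha> \<beta> (jacobi_op \<alpha> \<beta> p * q) = jacobi_int \<alpha> \<beta> (p * jacobi_op \<alpha> \<beta> q)"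
proof -
  let ?F = "\<lambda>x. (jacobi_weight (\<alpha> + 1) (\<beta> + 1) x * poly (pderiv p) x) * poly q x -
       (jacobi_weight (\<alpha> + 1) (\<beta> + 1) x * poly (pderiv q) x) * poly p x"
  let ?f = "\<lambda>x. poly (jacobi_op \<alpha> \<beta> p * q - p * jacobi_op \<alpha> \<beta> q) x * jacobi_weight \<alpha> \<beta> x"
  have "(?f has_integral (?F 1 - ?F (-1))) {-1..1}"
  proof (rule fundamental_theorem_of_calculus_interior)
    have "continuous_on {-1..1} (jacobi_weight (\<alpha> + 1) (\<beta> + 1))"
      unfolding jacobi_weight_def
      by (rule continuous_on_mult; rule continuous_on_powr') (use ab in \<open>auto intro!: continuous_intros\<close>)
    then show "continuous_on {-1..1} ?F"
      by (intro continuous_on_diff continuous_on_mult) (auto intro: continuous_intros)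
    fix x :: real assume x: "x \<in> {-1<..<1}"
    show "(?F has_vector_derivative ?f x) (at x)"
      unfolding has_real_derivative_iff_has_vector_derivative[symmetric]
      by (rule DERIV_cong[OF DERIV_diff[OF DERIV_mult[OF jacobi_flux_deriv[OF x] poly_DERIV]
              DERIV_mult[OF jacobi_flux_deriv[OF x] poly_DERIV]]]) (simp add: algebra_simps)
  qed auto
  then have "(?f has_integral 0) {-1..1}"
    using ab by (simp add: jacobi_weight_def)
  then have "jacobi_int \<alpha> \<beta> (jacobi_op \<alpha> \<beta> p * q - p * jacobi_op \<alpha> \<beta> q) = 0"
    using jacobi_int_has_integral[OF ab] has_integral_unique by blast
  then show ?thesis by (simp add: jacobi_int_diff[OF ab])
qed

text \<open>Taylor coefficients at \<open>x = 1\<close>, in powers of \<open>1 - x\<close>, of the eigenpolynomial with value 1 there: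
  the terminating hypergeometric series \<open>F(-n, n + \<alpha> + \<beta> + 1; \<alpha> + 1; (1 - x)/2)\<close>.\<close>

primrec jacobi_coeff :: "real \<Rightarrow> real \<Rightarrow> nat \<Rightarrow> nat \<Rightarrow> real" where
  "jacobi_coeff \<alpha> \<beta> n 0 = 1"
| "jacobi_coeff \<alpha> \<beta> n (Suc k) = - (real n - real k) * (real n + real k + \<alpha> + \<beta> + 1) /
     (2 * (real k + 1) * (real k + 1 + \<alpha>)) * jacobi_coeff \<alpha> \<beta> n k"

lemma jacobi_coeff_zero: "k > n \<Longrightarrow> jacobi_coeff \<alpha> \<beta> n k = 0"
  by (induction k) (auto simp: less_Suc_eq)

lemma jacobi_coeff_nonzero:
  assumes "\<alpha> > -1" "\<beta> > -1"
  shows "k \<le> n \<Longrightarrow> jacobi_coeff \<alpha> \<beta> n k \<noteq> 0"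
  by (induction k) (use assms in auto)

lemma jacobi_op_eigen_exists:
  assumes ab: "\<alpha> > -1" "\<beta> > -1"
  obtains p where "degree p = n" "jacobi_op \<alpha> \<beta> p = smult (- (real n * (real n + \<alpha> + \<beta> + 1))) p" "poly p 1 = 1"
proof -
  define lam where "lam = real n * (real n + \<alpha> + \<beta> + 1)"
  define q where "q = Abs_poly (jacobi_coeff \<alpha> \<beta> n)"
  have cq: "coeff q k = jacobi_coeff \<alpha> \<beta> n k" for k
    unfolding q_def by (subst coeff_Abs_poly[of n]) (auto simp: jacobi_coeff_zero)
  have dq: "degree q = n"
    by (rule antisym) (auto intro!: degree_le le_degree simp: cq jacobi_coeff_zero jacobi_coeff_nonzero[OF ab])
  have ode: "[:0, 2, -1:] * pderiv (pderiv q) + [:2 * \<alpha> + 2, - (\<alpha> + \<beta> + 2):] * pderiv q + smult lam q = 0"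
  proof (rule poly_eqI)
    fix k
    have rec: "2 * (real k + 1) * (real k + 1 + \<alpha>) * coeff q (Suc k) =
        - (real n - real k) * (real n + real k + \<alpha> + \<beta> + 1) * coeff q k"
      using ab by (simp add: cq)
    show "coeff ([:0, 2, -1:] * pderiv (pderiv q) + [:2 * \<alpha> + 2, - (\<alpha> + \<beta> + 2):] * pderiv q + smult lam q) k
       = coeff 0 k"
    proof (cases k)
      case 0
      then show ?thesis using rec by (simp add: coeff_pderiv lam_def algebra_simps)
    next
      case (Suc m)
      show ?thesis
      proof (cases m)
        case 0
        then show ?thesis using rec Suc
          by (simp add: coeff_pderiv lam_def algebra_simps)
      next
        case (Suc l)
        with \<open>k = Suc m\<close> show ?thesis using rec
          by (simp add: coeff_pderiv lam_def algebra_simps)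
      qed
    qed
  qed
  define p where "p = q \<circ>\<^sub>p [:1, -1:]"
  show thesis
  proof
    show "degree p = n" by (simp add: p_def degree_pcompose dq)
    have "poly q 0 = 1" by (simp add: poly_0_coeff_0 cq)
    then show "poly p 1 = 1" by (simp add: p_def poly_pcompose)
    show "jacobi_op \<alpha> \<beta> p = smult (- (real n * (real n + \<alpha> + \<beta> + 1))) p"
    proof (rule poly_ext)
      fix x
      have d1: "pderiv p = - (pderiv q \<circ>\<^sub>p [:1, -1:])"
        by (simp add: p_def pderiv_pcompose pderiv_pCons)
      have d2: "pderiv (pderiv p) = pderiv (pderiv q) \<circ>\<^sub>p [:1, -1:]"
        by (simp add: d1 pderiv_minus pderiv_pcompose pderiv_pCons)
      have "poly ([:0, 2, -1:] * pderiv (pderiv q) + [:2 * \<alpha> + 2, - (\<alpha> + \<beta> + 2):] * pderiv q + smult lam q) (1 - x) = 0"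
        unfolding ode by simp
      then show "poly (jacobi_op \<alpha> \<beta> p) x = poly (smult (- (real n * (real n + \<alpha> + \<beta> + 1))) p) x"
        unfolding poly_jacobi_op d2 unfolding d1 lam_def[symmetric]
        by (simp add: p_def poly_pcompose algebra_simps power2_eq_square)
    qed
  qed
qed

text \<open>Eigenpolynomials of different degrees have different eigenvalues, so self-adjointness makes them
  orthogonal; subtracting a multiple of the eigenpolynomial of degree \<open>degree q\<close> lowers the degree of \<open>q\<close>.\<close>

lemma jacobi_op_eigen_orth:
  assumes ab: "\<alpha> > -1" "\<beta> > -1"
    and p: "jacobi_op \<alpha> \<beta> p = smult (- (real n * (real n + \<alpha> + \<beta> + 1))) p"
  shows "jacobi_orth \<alpha> \<beta> n p"
proof -
  have "jacobi_int \<alpha> \<beta> (p * q) = 0" if "degree q < n" for q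
    using that
  proof (induction "degree q" arbitrary: q rule: less_induct)
    case less
    show ?case
    proof (cases "q = 0")
      case True then show ?thesis by (simp add: jacobi_int_def)
    next
      case False
      define m where "m = degree q"
      obtain e where e: "degree e = m" "jacobi_op \<alpha> \<beta> e = smult (- (real m * (real m + \<alpha> + \<beta> + 1))) e" "poly e 1 = 1"
        using jacobi_op_eigen_exists[OF ab] by blast
      have "m < n" using less.prems m_def by simp
      have le: "lead_coeff e \<noteq> 0" using e(3) by auto
      have "- (real n * (real n + \<alpha> + \<beta> + 1)) * jacobi_int \<alpha> \<beta> (p * e) =
            - (real m * (real m + \<alpha> + \<beta> + 1)) * jacobi_int \<alpha> \<beta> (p * e)"
        using jacobi_op_self_adjoint[OF ab, of p e]
        unfolding p e(2) mult_smult_left mult_smult_right jacobi_int_smult .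
      then have "(real n - real m) * (real n + real m + \<alpha> + \<beta> + 1) * jacobi_int \<alpha> \<beta> (p * e) = 0"
        by (simp add: algebra_simps)
      moreover have "real n - real m > 0" "real n + real m + \<alpha> + \<beta> + 1 > 0"
        using \<open>m < n\<close> ab by (auto simp: less_eq_Suc_le)
      ultimately have pe: "jacobi_int \<alpha> \<beta> (p * e) = 0" by simp
      define c where "c = lead_coeff q / lead_coeff e"
      define r where "r = q - smult c e"
      have "jacobi_int \<alpha> \<beta> (p * r) = 0"
      proof (cases "m = 0")
        case True
        then have "r = 0"
        proof -
          obtain a where a: "q = [:a:]" using True m_def degree_eq_zeroE by metis
          obtain b where b: "e = [:b:]" using True e degree_eq_zeroE by metis
          show ?thesis using le by (simp add: r_def c_def a b)
        qed
        then show ?thesis by (simp add: jacobi_int_def)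
      next
        case False
        have "degree r < m"
        proof (rule degree_lessI)
          show "r \<noteq> 0 \<or> 0 < m" using False by simp
          show "\<forall>k\<ge>m. coeff r k = 0"
          proof (intro allI impI)
            fix k assume "m \<le> k"
            show "coeff r k = 0"
            proof (cases "k = m")
              case True then show ?thesis using e(1) le by (simp add: r_def c_def m_def)
            next
              case False
              then have "m < k" using \<open>m \<le> k\<close> by simp
              then show ?thesis using e(1) by (simp add: r_def m_def coeff_eq_0)
            qed
          qed
        qed
        then show ?thesis using less m_def by auto
      qed
      moreover have "p * q = p * r + smult c (p * e)" by (simp add: r_def algebra_simps)
      ultimately show ?thesis by (simp add: jacobi_int_add[OF ab] jacobi_int_smult pe)
    qed
  qed
  then show ?thesis by (auto simp: jacobi_orth_def)
qed

text \<open>A combination \<open>r\<close> of two such polynomials that cancels the leading terms is orthogonal to itself.\<close>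

lemma jacobi_orth_unique:
  assumes ab: "\<alpha> > -1" "\<beta> > -1" and "degree p = n" "degree q = n" "jacobi_orth \<alpha> \<beta> n p" "jacobi_orth \<alpha> \<beta> n q"
    and "poly p 1 = poly q 1" "poly q 1 \<noteq> 0"
  shows "p = q"
proof -
  have q0: "coeff q n \<noteq> 0" using assms by (metis leading_coeff_0_iff poly_0)
  define c where "c = lead_coeff p / lead_coeff q"
  define r where "r = p - smult c q"
  have "r = 0"
  proof (rule ccontr)
    assume r: "r \<noteq> 0"
    have "degree r < n"
    proof (rule degree_lessI)
      show "r \<noteq> 0 \<or> 0 < n" using r by simp
      show "\<forall>k\<ge>n. coeff r k = 0"
      proof (intro allI impI)
        fix k assume "n \<le> k"
        then show "coeff r k = 0"
          using q0 assms(3,4) by (cases "k = n") (auto simp: r_def c_def coeff_eq_0 simp del: leading_coeff_0_iff)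
      qed
    qed
    then have "jacobi_int \<alpha> \<beta> (p * r) = 0" "jacobi_int \<alpha> \<beta> (q * r) = 0"
      using assms by (auto simp: jacobi_orth_def)
    then have "jacobi_int \<alpha> \<beta> (r * r) = 0"
      by (simp add: r_def left_diff_distrib jacobi_int_diff[OF ab] jacobi_int_smult)
    moreover have "jacobi_int \<alpha> \<beta> (r * r) > 0"
      by (rule jacobi_int_pos[OF ab]) (use r in auto)
    ultimately show False by simp
  qed
  then have "p = smult c q" by (simp add: r_def)
  moreover from this have "c = 1" using assms by auto
  ultimately show ?thesis by simp
qed

text \<open>Uniqueness identifies the polynomial of the definition with the multiple of the eigenpolynomial
  that has the prescribed value at 1, and so provides the differential equation.\<close>

lemma jacobi_poly_props:
  fixes \<alpha> \<beta> :: real and n :: nat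
  assumes ab: "\<alpha> > -1" "\<beta> > -1"
  defines "P \<equiv> jacobi_poly \<alpha> \<beta> n"
  shows "degree P = n" "jacobi_orth \<alpha> \<beta> n P" "poly P 1 \<noteq> 0"
    "jacobi_op \<alpha> \<beta> P = smult (- (real n * (real n + \<alpha> + \<beta> + 1))) P"
proof -
  define g where "g = (real n + \<alpha>) gchoose n"
  \<comment> \<open>The factors of the generalized binomial coefficient are \<open>\<alpha> + 1, \<dots>, \<alpha> + n\<close>, all positive.\<close>
  have g0: "g \<noteq> 0"
    unfolding g_def gbinomial_prod_rev using ab by (auto simp: of_nat_diff)
  obtain e where e: "degree e = n" "jacobi_op \<alpha> \<beta> e = smult (- (real n * (real n + \<alpha> + \<beta> + 1))) e" "poly e 1 = 1"
    using jacobi_op_eigen_exists[OF ab] by blast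
  have jacobi_op: "jacobi_op \<alpha> \<beta> (smult g e) = smult (- (real n * (real n + \<alpha> + \<beta> + 1))) (smult g e)"
  proof -
    have "jacobi_op \<alpha> \<beta> (smult g e) = smult g (jacobi_op \<alpha> \<beta> e)"
      unfolding jacobi_op_def pderiv_smult mult_smult_right smult_add_right ..
    then show ?thesis by (simp add: e(2) mult.commute)
  qed
  have orth: "jacobi_orth \<alpha> \<beta> n (smult g e)"
    by (rule jacobi_op_eigen_orth[OF ab jacobi_op])
  have eq: "(LINT x:{-1..1}|lborel. poly p x * poly q x * ((1 - x) powr \<alpha> * (1 + x) powr \<beta>)) = jacobi_int \<alpha> \<beta> (p * q)" for p q
    by (simp add: jacobi_int_def jacobi_weight_def)
  have "P = smult g e"
    unfolding P_def jacobi_poly_def eq jacobi_orth_def[symmetric] g_def[symmetric]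
  proof (rule the_equality)
    show "degree (smult g e) = n \<and> jacobi_orth \<alpha> \<beta> n (smult g e) \<and> poly (smult g e) 1 = g"
      using e orth g0 by simp
    fix p assume "degree p = n \<and> jacobi_orth \<alpha> \<beta> n p \<and> poly p 1 = g"
    then show "p = smult g e"
      using jacobi_orth_unique[OF ab, of p n "smult g e"] e orth g0 by auto
  qed
  then show "degree P = n" "jacobi_orth \<alpha> \<beta> n P" "poly P 1 \<noteq> 0"
    "jacobi_op \<alpha> \<beta> P = smult (- (real n * (real n + \<alpha> + \<beta> + 1))) P"
    using e orth jacobi_op g0 by auto
qed

section \<open>Zeros of orthogonal polynomials and the Lagrange basis\<close>

lemma split_root:
  fixes p :: "real poly"
  assumes "poly p r = 0"
  obtains s where "p = [:-r, 1:] * s" "p \<noteq> 0 \<Longrightarrow> degree p = Suc (degree s)"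
    "poly (pderiv p) r = poly s r" "p div [:-r, 1:] = s"
proof -
  obtain s where s: "p = [:-r, 1:] * s" using assms poly_eq_0_iff_dvd by (metis dvdE)
  show thesis
  proof (rule that[OF s])
    assume "p \<noteq> 0"
    then have "s \<noteq> 0" using s by auto
    then show "degree p = Suc (degree s)" unfolding s by (subst degree_mult_eq) auto
  next
    show "poly (pderiv p) r = poly s r" unfolding s by (simp only: pderiv_mult) (simp add: pderiv_pCons)
    show "p div [:-r, 1:] = s" unfolding s by (rule nonzero_mult_div_cancel_left) simp
  qed
qed

text \<open>With \<open>p = (x - r) s\<close> the polynomial \<open>p s = (x - r) s\<^sup>2\<close> would have a fixed sign on \<open>(-1, 1)\<close>.\<close>

lemma jacobi_orth_roots_inside:
  assumes ab: "\<alpha> > -1" "\<beta> > -1" and p: "degree p = n" "p \<noteq> 0" "jacobi_orth \<alpha> \<beta> n p" and r: "poly p r = 0"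
  shows "-1 < r \<and> r < 1"
proof (rule ccontr)
  assume out: "\<not> (-1 < r \<and> r < 1)"
  obtain s where s: "p = [:-r, 1:] * s" and ds: "p \<noteq> 0 \<Longrightarrow> degree p = Suc (degree s)"
    using split_root[OF r] by metis
  have s0: "s \<noteq> 0" using s p(2) by auto
  have "degree s < n" using ds p by simp
  then have z: "jacobi_int \<alpha> \<beta> (p * s) = 0" using p(3) by (simp add: jacobi_orth_def)
  have v: "poly (p * s) x = (x - r) * (poly s x)\<^sup>2" for x
    by (simp add: s algebra_simps power2_eq_square)
  have ps0: "p * s \<noteq> 0" using s0 p(2) by simp
  show False
  proof (cases "r \<le> -1")
    case True
    have "jacobi_int \<alpha> \<beta> (p * s) > 0"
      by (rule jacobi_int_pos[OF ab _ ps0]) (use True v in auto)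
    then show False using z by simp
  next
    case False
    have "jacobi_int \<alpha> \<beta> (smult (-1) (p * s)) > 0"
      by (rule jacobi_int_pos[OF ab]) (use False out v ps0 in \<open>auto simp: mult_le_0_iff\<close>)
    then show False using z by (simp only: jacobi_int_smult)
  qed
qed

text \<open>With \<open>p = (x - r)\<^sup>2 t\<close> the polynomial \<open>p t\<close> would be a square.\<close>

lemma jacobi_orth_roots_simple:
  assumes ab: "\<alpha> > -1" "\<beta> > -1" and p: "degree p = n" "p \<noteq> 0" "jacobi_orth \<alpha> \<beta> n p" and r: "poly p r = 0"
  shows "poly (pderiv p) r \<noteq> 0"
proof
  assume d: "poly (pderiv p) r = 0"
  obtain s where s: "p = [:-r, 1:] * s" and ds: "p \<noteq> 0 \<Longrightarrow> degree p = Suc (degree s)"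
    and sr: "poly (pderiv p) r = poly s r"
    using split_root[OF r] by metis
  obtain t where t: "s = [:-r, 1:] * t" and dt: "s \<noteq> 0 \<Longrightarrow> degree s = Suc (degree t)"
    using split_root[of s r] sr d by metis
  have s0: "s \<noteq> 0" using s p(2) by auto
  then have t0: "t \<noteq> 0" using t by auto
  have "degree t < n" using ds dt s0 p by simp
  then have "jacobi_int \<alpha> \<beta> (p * t) = 0" using p(3) by (simp add: jacobi_orth_def)
  moreover have "poly (p * t) x = ((x - r) * poly t x)\<^sup>2" for x
    by (simp add: s t algebra_simps power2_eq_square)
  then have "jacobi_int \<alpha> \<beta> (p * t) > 0"
    by (intro jacobi_int_pos[OF ab]) (use t0 p(2) in auto)
  ultimately show False by simp
qed

lemma prod_root_factors_dvd:
  fixes p :: "real poly"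
  assumes "finite F" "\<And>r. r \<in> F \<Longrightarrow> poly p r = 0"
  shows "(\<Prod>r\<in>F. [:-r, 1:]) dvd p"
  using assms
proof (induction F rule: finite_induct)
  case empty then show ?case by simp
next
  case (insert r F)
  obtain q where q: "p = (\<Prod>r\<in>F. [:-r, 1:]) * q" using insert by (metis dvdE insertCI)
  have "poly (\<Prod>r\<in>F. [:-r, 1:]) r \<noteq> 0" using insert.hyps by (auto simp: poly_prod)
  moreover have "poly p r = 0" using insert.prems by simp
  ultimately have "poly q r = 0" by (simp add: q)
  then have "[:-r, 1:] dvd q" by (simp add: poly_eq_0_iff_dvd)
  then have "[:-r, 1:] * (\<Prod>r\<in>F. [:-r, 1:]) dvd q * (\<Prod>r\<in>F. [:-r, 1:])"
    by (rule mult_dvd_mono) simp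
  also have "[:-r, 1:] * (\<Prod>r\<in>F. [:-r, 1:]) = (\<Prod>r\<in>insert r F. [:-r, 1:])"
    using insert.hyps by (rule prod.insert[symmetric])
  finally show ?case unfolding q by (simp only: mult.commute)
qed

text \<open>Let \<open>D\<close> be the product of the linear factors at the zeros. All zeros are simple, so \<open>p = D q\<close> with \<open>q\<close>
  free of zeros, hence of one sign. With fewer than \<open>n\<close> zeros \<open>p\<close> would be orthogonal to \<open>D\<close>,
  although \<open>p D = q D\<^sup>2\<close> has one sign.\<close>

lemma jacobi_orth_card_roots:
  assumes ab: "\<alpha> > -1" "\<beta> > -1" and p: "degree p = n" "p \<noteq> 0" "jacobi_orth \<alpha> \<beta> n p"
  shows "card {x. poly p x = 0} = n"
proof (rule antisym)
  let ?R = "{x. poly p x = 0}"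
  have fin: "finite ?R" using poly_roots_finite[OF p(2)] .
  show "card ?R \<le> n" using card_poly_roots_bound[of p] p by simp
  show "n \<le> card ?R"
  proof (rule ccontr)
    assume "\<not> n \<le> card ?R"
    define D where "D = (\<Prod>r\<in>?R. [:-r, 1:])"
    have Dr: "poly D r = 0" if "r \<in> ?R" for r
      using that fin by (auto simp: D_def poly_prod)
    have D0: "D \<noteq> 0" by (simp add: D_def fin)
    have dD: "degree D = card ?R"
      unfolding D_def using fin by (subst degree_prod_eq_sum_degree) auto
    obtain q where q: "p = D * q" using prod_root_factors_dvd[OF fin, of p] by (auto simp: D_def)
    have qn: "poly q x \<noteq> 0" for x
    proof
      assume x: "poly q x = 0"
      then have px: "poly p x = 0" by (simp add: q)
      then have "poly (pderiv p) x = 0" using x Dr[of x] by (simp add: q pderiv_mult)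
      then show False using jacobi_orth_roots_simple[OF ab p px] by simp
    qed
    have sgn: "(\<forall>x. poly q x > 0) \<or> (\<forall>x. poly q x < 0)"
    proof (rule ccontr)
      assume "\<not> ?thesis"
      then obtain x y where "poly q x < 0" "poly q y > 0" using qn by (metis linorder_neqE_linordered_idom)
      then show False using qn poly_IVT[of x y q] poly_IVT[of y x q]
        by (metis linorder_neqE_linordered_idom mult_neg_pos mult_pos_neg order_less_asym)
    qed
    have z: "jacobi_int \<alpha> \<beta> (p * D) = 0" using p(3) \<open>\<not> n \<le> card ?R\<close> dD by (simp add: jacobi_orth_def)
    have v: "poly (p * D) x = poly q x * (poly D x)\<^sup>2" for x by (simp add: q power2_eq_square)
    have ne: "p * D \<noteq> 0" using D0 p(2) by simp
    from sgn show False
    proof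
      assume h: "\<forall>x. poly q x > 0"
      have "jacobi_int \<alpha> \<beta> (p * D) > 0"
        by (rule jacobi_int_pos[OF ab _ ne]) (use h in \<open>simp add: v less_imp_le del: poly_mult\<close>)
      then show False using z by simp
    next
      assume h: "\<forall>x. poly q x < 0"
      have "jacobi_int \<alpha> \<beta> (smult (-1) (p * D)) > 0"
        by (rule jacobi_int_pos[OF ab]) (use h ne in \<open>simp_all add: v less_imp_le mult_le_0_iff del: poly_mult\<close>)
      then show False using z by (simp only: jacobi_int_smult)
    qed
  qed
qed

definition lagrange_basis :: "real poly \<Rightarrow> real \<Rightarrow> real poly" where
  "lagrange_basis P r = smult (1 / poly (pderiv P) r) (P div [:-r, 1:])"

lemma lagrange_basis_mult:
  assumes "poly P r = 0" "poly (pderiv P) r \<noteq> 0"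
  shows "poly (lagrange_basis P r) x * (poly (pderiv P) r * (x - r)) = poly P x"
proof -
  obtain s where s: "P = [:-r, 1:] * s" and "P div [:-r, 1:] = s"
    using split_root[OF assms(1)] by metis
  then have "poly (lagrange_basis P r) x * (poly (pderiv P) r * (x - r)) = poly s x * (x - r)"
    using assms(2) by (simp add: lagrange_basis_def)
  then show ?thesis by (simp add: s algebra_simps)
qed

lemma lagrange_basis_self:
  assumes "poly P r = 0" "poly (pderiv P) r \<noteq> 0"
  shows "poly (lagrange_basis P r) r = 1"
proof -
  obtain s where "poly (pderiv P) r = poly s r" "P div [:-r, 1:] = s"
    using split_root[OF assms(1)] by metis
  then show ?thesis using assms(2) by (simp add: lagrange_basis_def)
qed

lemma lagrange_basis_other:
  assumes "poly P r = 0" "poly (pderiv P) r \<noteq> 0" "poly P s = 0" "s \<noteq> r"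
  shows "poly (lagrange_basis P r) s = 0"
  using lagrange_basis_mult[OF assms(1,2), of s] assms by auto

lemma degree_lagrange_basis:
  assumes "P \<noteq> 0" "poly P r = 0"
  shows "degree (lagrange_basis P r) \<le> degree P - 1"
proof -
  obtain s where "degree P = Suc (degree s)" "P div [:-r, 1:] = s"
    using split_root[OF assms(2)] assms(1) by metis
  then show ?thesis by (simp add: lagrange_basis_def)
qed

section \<open>Behaviour near the end points\<close>

text \<open>Let \<open>M\<close> be the maximum of \<open>\<bar>y\<bar>\<close> on \<open>[1 - h, 1]\<close>. In divergence form the equation reads
  \<open>F' = - lam w y\<close> with \<open>F = (1 - x) powr (\<alpha> + 1) * (1 + x) powr (\<beta> + 1) * y'\<close>. Cauchy's mean value theorem for
  \<open>F\<close> and \<open>G = (1 - x) powr (\<alpha> + 1)\<close>, which both vanish at 1, bounds \<open>\<bar>y'\<bar>\<close> by a constant times \<open>lam M\<close>.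
  The condition on \<open>h\<close> then keeps \<open>y\<close> within \<open>M/3\<close> of its extreme value.\<close>

lemma jacobi_op_endpoint:
  assumes \<alpha>: "\<alpha> > -1" and ode: "jacobi_op \<alpha> \<beta> y = smult (- lam) y" and "lam \<ge> 0" "y \<noteq> 0"
    and h: "0 < h" "h \<le> 1" "2 powr \<bar>\<beta>\<bar> / (\<alpha> + 1) * lam * h \<le> 1/3"  and \<beta>: "\<beta> > -1"
    and x: "x \<in> {1-h..1}" "x' \<in> {1-h..1}"
  shows "\<bar>poly y x'\<bar> \<le> 3 * \<bar>poly y x\<bar>" "poly y x \<noteq> 0"
proof -
  have "\<exists>z\<in>{1-h..1}. \<forall>w\<in>{1-h..1}. \<bar>poly y w\<bar> \<le> \<bar>poly y z\<bar>"
    by (rule continuous_attains_sup) (use h in \<open>auto intro!: continuous_intros\<close>)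
  then obtain z where z: "z \<in> {1-h..1}" "\<And>w. w \<in> {1-h..1} \<Longrightarrow> \<bar>poly y w\<bar> \<le> \<bar>poly y z\<bar>" by blast
  define M where "M = \<bar>poly y z\<bar>"
  have "M > 0"
  proof (rule ccontr)
    assume "\<not> M > 0"
    then have "{1-h..1} \<subseteq> {x. poly y x = 0}" using z(2) by (force simp: M_def)
    moreover have "infinite {1-h..1}" using h by (simp add: infinite_Icc)
    ultimately show False using poly_roots_finite[OF \<open>y \<noteq> 0\<close>] finite_subset by blast
  qed
  have der: "\<bar>poly (pderiv y) t\<bar> \<le> 2 powr \<bar>\<beta>\<bar> / (\<alpha> + 1) * lam * M" if t: "1 - h \<le> t" "t < 1" for t
  proof -
    define F where "F = (\<lambda>x. jacobi_weight (\<alpha> + 1) (\<beta> + 1) x * poly (pderiv y) x)"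
    define G where "G = (\<lambda>x::real. (1 - x) powr (\<alpha> + 1))"
    have cont: "continuous_on {t..1} F" "continuous_on {t..1} G"
    proof -
      show G: "continuous_on {t..1} G" unfolding G_def
        by (rule continuous_on_powr') (use \<alpha> in \<open>auto intro!: continuous_intros\<close>)
      have "continuous_on {t..1} (\<lambda>x. (1 + x) powr (\<beta> + 1))"
        by (rule continuous_on_powr') (use \<beta> t h in \<open>auto intro!: continuous_intros\<close>)
      with G show "continuous_on {t..1} F" unfolding F_def jacobi_weight_def
        by (intro continuous_on_mult) (auto intro!: continuous_intros simp: G_def)
    qed
    have "\<exists>\<xi>. t < \<xi> \<and> \<xi> < 1 \<and>
       (\<lambda>v. (jacobi_weight \<alpha> \<beta> \<xi> * poly (jacobi_op \<alpha> \<beta> y) \<xi> * G t - - ((\<alpha> + 1) * (1 - \<xi>) powr \<alpha>) * F t) * v) = (\<lambda>v. 0)"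
    proof (rule Rolle_deriv[where f = "\<lambda>x. F x * G t - G x * F t"])
      show "t < 1" by fact
      show "F t * G t - G t * F t = F 1 * G t - G 1 * F t"
        using \<alpha> by (simp add: F_def G_def jacobi_weight_def)
      show "continuous_on {t..1} (\<lambda>x. F x * G t - G x * F t)"
        by (intro continuous_intros cont)
      fix x :: real assume x: "t < x" "x < 1"
      have 1: "(F has_real_derivative jacobi_weight \<alpha> \<beta> x * poly (jacobi_op \<alpha> \<beta> y) x) (at x)"
        unfolding F_def by (rule jacobi_flux_deriv) (use x t h in auto)
      have 2: "(G has_real_derivative - ((\<alpha> + 1) * (1 - x) powr \<alpha>)) (at x)"
        unfolding G_def using x by (auto intro!: derivative_eq_intros simp: powr_diff)
      show "((\<lambda>x. F x * G t - G x * F t) has_derivative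
        (\<lambda>v. (jacobi_weight \<alpha> \<beta> x * poly (jacobi_op \<alpha> \<beta> y) x * G t - - ((\<alpha> + 1) * (1 - x) powr \<alpha>) * F t) * v)) (at x)"
        unfolding has_field_derivative_def[symmetric]
        by (rule DERIV_cong[OF DERIV_diff[OF DERIV_mult[OF 1 DERIV_const] DERIV_mult[OF 2 DERIV_const]]]) simp
    qed
    then obtain \<xi> where \<xi>: "t < \<xi>" "\<xi> < 1" and
      "(jacobi_weight \<alpha> \<beta> \<xi> * poly (jacobi_op \<alpha> \<beta> y) \<xi> * G t - - ((\<alpha> + 1) * (1 - \<xi>) powr \<alpha>) * F t) * 1 = 0"
      by metis
    then have e: "(1 - \<xi>) powr \<alpha> * (1 - t) powr (\<alpha> + 1) * ((\<alpha> + 1) * ((1 + t) powr (\<beta> + 1) * poly (pderiv y) t)) =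
        (1 - \<xi>) powr \<alpha> * (1 - t) powr (\<alpha> + 1) * (lam * ((1 + \<xi>) powr \<beta> * poly y \<xi>))"
      by (simp add: F_def G_def jacobi_weight_def ode mult_ac)
    have "(1 - \<xi>) powr \<alpha> * (1 - t) powr (\<alpha> + 1) \<noteq> 0" using \<xi> t by simp
    with e have e: "(\<alpha> + 1) * ((1 + t) powr (\<beta> + 1) * poly (pderiv y) t) = lam * ((1 + \<xi>) powr \<beta> * poly y \<xi>)"
      using mult_left_cancel by blast
    have "\<xi> \<in> {1-h..1}" using \<xi> t by auto
    then have My: "\<bar>poly y \<xi>\<bar> \<le> M" using z(2) M_def by simp
    have b1: "(1 + \<xi>) powr \<beta> \<le> 2 powr \<bar>\<beta>\<bar>"
    proof -
      have "(1 + \<xi>) powr \<beta> \<le> (1 + \<xi>) powr \<bar>\<beta>\<bar>" by (rule powr_mono) (use \<xi> t h in auto)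
      also have "\<dots> \<le> 2 powr \<bar>\<beta>\<bar>" by (rule powr_mono2) (use \<xi> t h in auto)
      finally show ?thesis .
    qed
    have b2: "(1 + t) powr (\<beta> + 1) \<ge> 1" by (rule ge_one_powr_ge_zero) (use t h \<beta> in auto)
    have "(\<alpha> + 1) * \<bar>poly (pderiv y) t\<bar> \<le> (\<alpha> + 1) * ((1 + t) powr (\<beta> + 1) * \<bar>poly (pderiv y) t\<bar>)"
      using b2 \<alpha> by (intro mult_left_mono) (auto simp: mult_le_cancel_right1)
    also have "\<dots> = \<bar>(\<alpha> + 1) * ((1 + t) powr (\<beta> + 1) * poly (pderiv y) t)\<bar>"
      using \<alpha> by (simp add: abs_mult)
    also have "\<dots> = lam * ((1 + \<xi>) powr \<beta> * \<bar>poly y \<xi>\<bar>)"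
      unfolding e using \<open>lam \<ge> 0\<close> by (simp add: abs_mult)
    also have "\<dots> \<le> lam * (2 powr \<bar>\<beta>\<bar> * M)"
      using b1 My \<open>lam \<ge> 0\<close> by (intro mult_left_mono mult_mono) auto
    finally show ?thesis using \<alpha> by (simp add: field_simps)
  qed
  have diff: "\<bar>poly y s - poly y t\<bar> \<le> M / 3" if st: "s \<in> {1-h..1}" "t \<in> {1-h..1}" "t < s" for s t
  proof -
    obtain \<xi> where \<xi>: "t < \<xi>" "\<xi> < s" "poly y s - poly y t = (s - t) * poly (pderiv y) \<xi>"
      using poly_MVT[OF st(3)] by blast
    have "\<bar>poly y s - poly y t\<bar> = (s - t) * \<bar>poly (pderiv y) \<xi>\<bar>"
      unfolding \<xi>(3) using st by (simp add: abs_mult)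
    also have "\<dots> \<le> h * (2 powr \<bar>\<beta>\<bar> / (\<alpha> + 1) * lam * M)"
      by (rule mult_mono) (use st \<xi> der[of \<xi>] h in auto)
    also have "\<dots> = (2 powr \<bar>\<beta>\<bar> / (\<alpha> + 1) * lam * h) * M" by simp
    also have "\<dots> \<le> 1/3 * M" using h \<open>M > 0\<close> by (intro mult_right_mono) auto
    finally show ?thesis by simp
  qed
  have "\<bar>poly y z - poly y x\<bar> \<le> M / 3"
  proof (cases x z rule: linorder_cases)
    case less then show ?thesis using diff[of z x] x z by auto
  next
    case equal then show ?thesis using \<open>M > 0\<close> by simp
  next
    case greater then show ?thesis using diff[of x z] x z by (auto simp: abs_minus_commute)
  qed
  then have "M / 3 \<le> \<bar>poly y x\<bar>" using \<open>M > 0\<close> M_def by linarith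
  moreover have "\<bar>poly y x'\<bar> \<le> M" using z(2) x M_def by simp
  ultimately show "\<bar>poly y x'\<bar> \<le> 3 * \<bar>poly y x\<bar>" "poly y x \<noteq> 0" using \<open>M > 0\<close> by auto
qed

text \<open>The reflection \<open>x \<mapsto> -x\<close> exchanges the parameters, and carries results at 1 over to -1.\<close>

lemma jacobi_op_reflect:
  assumes "jacobi_op \<alpha> \<beta> y = smult c y"
  shows "jacobi_op \<beta> \<alpha> (y \<circ>\<^sub>p [:0, -1:]) = smult c (y \<circ>\<^sub>p [:0, -1:])"
proof (rule poly_ext)
  fix x
  have d1: "pderiv (y \<circ>\<^sub>p [:0, -1:]) = - (pderiv y \<circ>\<^sub>p [:0, -1:])"
    by (simp add: pderiv_pcompose pderiv_pCons)
  have d2: "pderiv (pderiv (y \<circ>\<^sub>p [:0, -1:])) = pderiv (pderiv y) \<circ>\<^sub>p [:0, -1:]"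
    by (simp add: d1 pderiv_minus pderiv_pcompose pderiv_pCons)
  have "poly (jacobi_op \<alpha> \<beta> y) (-x) = c * poly y (-x)" by (simp add: assms)
  then show "poly (jacobi_op \<beta> \<alpha> (y \<circ>\<^sub>p [:0, -1:])) x = poly (smult c (y \<circ>\<^sub>p [:0, -1:])) x"
    unfolding poly_jacobi_op d2 unfolding d1
    by (simp add: poly_pcompose algebra_simps)
qed

section \<open>Energy of perturbed oscillators\<close>

text \<open>For \<open>E = v\<^sup>2 + N\<^sup>2 u\<^sup>2\<close> the equation gives \<open>E' = - 2 g u v\<close>, so \<open>\<bar>E'\<bar> \<le> \<bar>g\<bar>/N * E \<le> \<phi> E\<close>. Therefore
  \<open>E exp \<Phi>\<close> increases and \<open>E exp (- \<Phi>)\<close> decreases.\<close>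

lemma energy_comparison:
  fixes u v g \<Phi> \<phi> :: "real \<Rightarrow> real"
  assumes N: "N > 0"
    and u: "\<And>t. t \<in> {a..b} \<Longrightarrow> (u has_real_derivative v t) (at t)"
    and v: "\<And>t. t \<in> {a..b} \<Longrightarrow> (v has_real_derivative - (N\<^sup>2 + g t) * u t) (at t)"
    and \<Phi>: "\<And>t. t \<in> {a..b} \<Longrightarrow> (\<Phi> has_real_derivative \<phi> t) (at t)"
    and g: "\<And>t. t \<in> {a..b} \<Longrightarrow> \<bar>g t\<bar> \<le> N * \<phi> t"
    and \<kappa>: "\<And>t. t \<in> {a..b} \<Longrightarrow> \<bar>\<Phi> t\<bar> \<le> \<kappa>"
    and st: "s \<in> {a..b}" "t \<in> {a..b}"
  shows "(v s)\<^sup>2 + N\<^sup>2 * (u s)\<^sup>2 \<le> exp (2 * \<kappa>) * ((v t)\<^sup>2 + N\<^sup>2 * (u t)\<^sup>2)"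
proof -
  define E where "E = (\<lambda>t. (v t)\<^sup>2 + N\<^sup>2 * (u t)\<^sup>2)"
  have E0: "E t \<ge> 0" for t by (simp add: E_def)
  have dE: "(E has_real_derivative (- 2 * g t * u t * v t)) (at t)" if "t \<in> {a..b}" for t
    unfolding E_def
    by (rule derivative_eq_intros u[OF that] v[OF that] refl)+ (simp add: algebra_simps power2_eq_square)
  have bE: "\<bar>- 2 * g t * u t * v t\<bar> \<le> \<phi> t * E t" if "t \<in> {a..b}" for t
  proof -
    have "N * (2 * \<bar>u t\<bar> * \<bar>v t\<bar>) \<le> E t"
      using sum_squares_bound[of "\<bar>v t\<bar>" "N * \<bar>u t\<bar>"] by (simp add: E_def power_mult_distrib mult_ac)
    then have "\<bar>g t\<bar> * (N * (2 * \<bar>u t\<bar> * \<bar>v t\<bar>)) \<le> (N * \<phi> t) * E t"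
      by (intro mult_mono g[OF that]) (use N g[OF that] in auto)
    then have "N * (\<bar>- 2 * g t * u t * v t\<bar>) \<le> N * (\<phi> t * E t)"
      by (simp add: abs_mult mult_ac)
    then show ?thesis using N by simp
  qed
  have inc: "E x * exp (\<Phi> x) \<le> E y * exp (\<Phi> y)" if "x \<in> {a..b}" "y \<in> {a..b}" "x \<le> y" for x y
  proof (rule DERIV_nonneg_imp_nondecreasing[OF that(3)])
    fix z assume z: "x \<le> z" "z \<le> y"
    then have z': "z \<in> {a..b}" using that by auto
    have "((\<lambda>x. E x * exp (\<Phi> x)) has_real_derivative (- 2 * g z * u z * v z + \<phi> z * E z) * exp (\<Phi> z)) (at z)"
      by (rule derivative_eq_intros dE[OF z'] \<Phi>[OF z'] refl)+ (simp add: algebra_simps)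
    moreover have "(- 2 * g z * u z * v z + \<phi> z * E z) * exp (\<Phi> z) \<ge> 0"
      using bE[OF z'] by (intro mult_nonneg_nonneg) auto
    ultimately show "\<exists>d. ((\<lambda>x. E x * exp (\<Phi> x)) has_real_derivative d) (at z) \<and> 0 \<le> d" by blast
  qed
  have dec: "E y * exp (- \<Phi> y) \<le> E x * exp (- \<Phi> x)" if "x \<in> {a..b}" "y \<in> {a..b}" "x \<le> y" for x y
  proof (rule DERIV_nonpos_imp_nonincreasing[OF that(3)])
    fix z assume z: "x \<le> z" "z \<le> y"
    then have z': "z \<in> {a..b}" using that by auto
    have "((\<lambda>x. E x * exp (- \<Phi> x)) has_real_derivative (- 2 * g z * u z * v z - \<phi> z * E z) * exp (- \<Phi> z)) (at z)"
      by (rule derivative_eq_intros dE[OF z'] \<Phi>[OF z'] refl)+ (simp add: algebra_simps)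
    moreover have "(- 2 * g z * u z * v z - \<phi> z * E z) * exp (- \<Phi> z) \<le> 0"
      using bE[OF z'] by (intro mult_nonpos_nonneg) auto
    ultimately show "\<exists>d. ((\<lambda>x. E x * exp (- \<Phi> x)) has_real_derivative d) (at z) \<and> d \<le> 0" by blast
  qed
  have "E s \<le> exp (2 * \<kappa>) * E t"
  proof -
    \<comment> \<open>Take \<open>w = \<Phi> s\<close> or \<open>w = - \<Phi> s\<close> according to the order of \<open>s\<close> and \<open>t\<close>.\<close>
    obtain w where w: "E s * exp w \<le> E t * exp (w + 2 * \<kappa>)"
    proof (cases "s \<le> t")
      case True
      have "E s * exp (\<Phi> s) \<le> E t * exp (\<Phi> t)" using inc st True by blast
      also have "\<dots> \<le> E t * exp (\<Phi> s + 2 * \<kappa>)"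
        using \<kappa>[OF st(1)] \<kappa>[OF st(2)] E0 by (intro mult_left_mono) (auto simp: abs_le_iff)
      finally show ?thesis using that by blast
    next
      case False
      have "E s * exp (- \<Phi> s) \<le> E t * exp (- \<Phi> t)" using dec st False by simp
      also have "\<dots> \<le> E t * exp (- \<Phi> s + 2 * \<kappa>)"
        using \<kappa>[OF st(1)] \<kappa>[OF st(2)] E0 by (intro mult_left_mono) (auto simp: abs_le_iff)
      finally show ?thesis using that by blast
    qed
    then have "E s * exp w \<le> (exp (2 * \<kappa>) * E t) * exp w" by (simp add: exp_add mult_ac)
    then show ?thesis by simp
  qed
  then show ?thesis by (simp add: E_def)
qed

text \<open>At the zero \<open>s\<close> the energy is \<open>(v s)\<^sup>2\<close>, so comparability bounds \<open>\<bar>v\<bar>\<close> and \<open>N \<bar>u\<bar>\<close> everywhere by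
  \<open>exp \<kappa> * \<bar>v s\<bar>\<close>. The first bound and the mean value theorem control \<open>u\<close> near \<open>s\<close>. Between two
  zeros \<open>v\<close> vanishes somewhere by Rolle's theorem; as \<open>\<bar>v'\<bar>\<close> is at most of order \<open>N \<bar>v s\<bar>\<close>, going from
  \<open>v s\<close> to 0 takes a distance of order \<open>1/N\<close>.\<close>

lemma energy_consequences:
  fixes u v g :: "real \<Rightarrow> real"
  assumes N: "N > 0" and K: "K \<ge> 0"
    and u: "\<And>t. t \<in> {a..b} \<Longrightarrow> (u has_real_derivative v t) (at t)"
    and v: "\<And>t. t \<in> {a..b} \<Longrightarrow> (v has_real_derivative - (N\<^sup>2 + g t) * u t) (at t)"
    and g: "\<And>t. t \<in> {a..b} \<Longrightarrow> \<bar>g t\<bar> \<le> K * N\<^sup>2"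
    and E: "\<And>s t. s \<in> {a..b} \<Longrightarrow> t \<in> {a..b} \<Longrightarrow>
       (v s)\<^sup>2 + N\<^sup>2 * (u s)\<^sup>2 \<le> exp (2 * \<kappa>) * ((v t)\<^sup>2 + N\<^sup>2 * (u t)\<^sup>2)"
    and nz: "t0 \<in> {a..b}" "u t0 \<noteq> 0"
    and s: "s \<in> {a..b}" "u s = 0"
  shows "t \<in> {a..b} \<Longrightarrow> \<bar>u t\<bar> \<le> exp \<kappa> * \<bar>v s\<bar> * min (1 / N) \<bar>t - s\<bar>"
    and "s' \<in> {a..b} \<Longrightarrow> u s' = 0 \<Longrightarrow> s' \<noteq> s \<Longrightarrow> 1 / (exp \<kappa> * (1 + K)) \<le> N * \<bar>s' - s\<bar>"
proof -
  have e2: "exp (2 * \<kappa>) = (exp \<kappa>)\<^sup>2" by (simp add: exp_double)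
  have vb: "\<bar>v t\<bar> \<le> exp \<kappa> * \<bar>v s\<bar>" if "t \<in> {a..b}" for t
  proof (rule power2_le_imp_le)
    have "(v t)\<^sup>2 \<le> (v t)\<^sup>2 + N\<^sup>2 * (u t)\<^sup>2" by simp
    also have "\<dots> \<le> exp (2 * \<kappa>) * (v s)\<^sup>2" using E[OF that s(1)] s(2) by simp
    finally show "\<bar>v t\<bar>\<^sup>2 \<le> (exp \<kappa> * \<bar>v s\<bar>)\<^sup>2" by (simp add: e2 power_mult_distrib)
  qed auto
  have ub: "N * \<bar>u t\<bar> \<le> exp \<kappa> * \<bar>v s\<bar>" if "t \<in> {a..b}" for t
  proof (rule power2_le_imp_le)
    have "N\<^sup>2 * (u t)\<^sup>2 \<le> (v t)\<^sup>2 + N\<^sup>2 * (u t)\<^sup>2" by simp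
    also have "\<dots> \<le> exp (2 * \<kappa>) * (v s)\<^sup>2" using E[OF that s(1)] s(2) by simp
    finally show "(N * \<bar>u t\<bar>)\<^sup>2 \<le> (exp \<kappa> * \<bar>v s\<bar>)\<^sup>2" by (simp add: e2 power_mult_distrib)
  qed auto
  have lip: "\<bar>f y - f x\<bar> \<le> B * \<bar>y - x\<bar>"
    if "x \<in> {a..b}" "y \<in> {a..b}" "\<And>t. t \<in> {a..b} \<Longrightarrow> (f has_real_derivative f' t) (at t)"
      "\<And>t. t \<in> {a..b} \<Longrightarrow> \<bar>f' t\<bar> \<le> B" for f f' x y B
    using field_differentiable_bound[of "{a..b}" f f' B y x] that
    by (auto intro: has_field_derivative_at_within)
  show "\<bar>u t\<bar> \<le> exp \<kappa> * \<bar>v s\<bar> * min (1 / N) \<bar>t - s\<bar>" if t: "t \<in> {a..b}"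
  proof -
    have "\<bar>u t\<bar> \<le> exp \<kappa> * \<bar>v s\<bar> * \<bar>t - s\<bar>" using lip[OF s(1) t u vb] s(2) by simp
    moreover have "\<bar>u t\<bar> \<le> exp \<kappa> * \<bar>v s\<bar> * (1 / N)" using ub[OF t] N by (simp add: field_simps)
    ultimately show ?thesis by (simp add: min_def)
  qed
  have vs: "\<bar>v s\<bar> > 0"
  proof (rule ccontr)
    assume "\<not> \<bar>v s\<bar> > 0"
    then show False using ub[OF nz(1)] nz(2) N by (simp add: mult_le_0_iff)
  qed
  show "1 / (exp \<kappa> * (1 + K)) \<le> N * \<bar>s' - s\<bar>" if s': "s' \<in> {a..b}" "u s' = 0" "s' \<noteq> s"
  proof -
    have "\<exists>\<xi>. min s s' < \<xi> \<and> \<xi> < max s s' \<and> (\<lambda>h. v \<xi> * h) = (\<lambda>h. 0)"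
    proof (rule Rolle_deriv)
      show "min s s' < max s s'" using s' by auto
      show "u (min s s') = u (max s s')" using s s' by (simp add: min_def max_def)
      show "continuous_on {min s s'..max s s'} u"
        using s s' by (intro continuous_at_imp_continuous_on ballI DERIV_isCont[OF u]) auto
      fix x assume "min s s' < x" "x < max s s'"
      then show "(u has_derivative (\<lambda>h. v x * h)) (at x)"
        using u[of x] s s' by (auto simp: has_field_derivative_def min_def max_def split: if_splits)
    qed
    then obtain \<xi> where \<xi>: "min s s' < \<xi>" "\<xi> < max s s'" "v \<xi> = 0" by (metis mult.right_neutral)
    have \<xi>': "\<xi> \<in> {a..b}" using \<xi> s s' by auto
    have b: "\<bar>- (N\<^sup>2 + g t) * u t\<bar> \<le> N * (1 + K) * (exp \<kappa> * \<bar>v s\<bar>)" if t: "t \<in> {a..b}" for t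
    proof -
      have "\<bar>N\<^sup>2 + g t\<bar> \<le> (1 + K) * N\<^sup>2" using g[OF t] by (simp add: abs_le_iff algebra_simps) (smt (verit) zero_le_power2)
      then have "\<bar>N\<^sup>2 + g t\<bar> * \<bar>u t\<bar> \<le> ((1 + K) * N\<^sup>2) * \<bar>u t\<bar>" by (intro mult_right_mono) auto
      also have "\<dots> = N * (1 + K) * (N * \<bar>u t\<bar>)" by (simp add: power2_eq_square)
      also have "\<dots> \<le> N * (1 + K) * (exp \<kappa> * \<bar>v s\<bar>)" using N K ub[OF t] by (intro mult_left_mono) auto
      finally show ?thesis unfolding abs_mult abs_minus_cancel .
    qed
    have "\<bar>v s - v \<xi>\<bar> \<le> N * (1 + K) * (exp \<kappa> * \<bar>v s\<bar>) * \<bar>s - \<xi>\<bar>"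
      by (rule lip[OF \<xi>' s(1) v b])
    then have "1 * \<bar>v s\<bar> \<le> (N * (1 + K) * exp \<kappa> * \<bar>s - \<xi>\<bar>) * \<bar>v s\<bar>" using \<xi> by (simp add: mult_ac)
    then have "1 \<le> N * (1 + K) * exp \<kappa> * \<bar>s - \<xi>\<bar>" using vs by (simp only: mult_le_cancel_right_pos)
    also have "\<dots> \<le> N * (1 + K) * exp \<kappa> * \<bar>s' - s\<bar>" using \<xi> N K by (intro mult_left_mono) auto
    finally have "1 \<le> N * \<bar>s' - s\<bar> * (exp \<kappa> * (1 + K))" by (simp only: mult_ac)
    moreover have "exp \<kappa> * (1 + K) > 0" using K by (simp add: add_pos_nonneg)
    ultimately show ?thesis by (simp only: pos_divide_le_eq)
  qed
qed

section \<open>The trigonometric form of the Jacobi equation\<close>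

lemma sin_ge_half:
  assumes "0 \<le> x" "x \<le> pi / 2"
  shows "x / 2 \<le> sin x"
proof (cases "x \<le> pi / 3")
  case True
  have "sin 0 - 0 / 2 \<le> sin x - x / 2"
  proof (rule DERIV_nonneg_imp_nondecreasing[OF assms(1)])
    fix y assume y: "0 \<le> y" "y \<le> x"
    have "cos y \<ge> cos (pi / 3)" by (rule cos_monotone_0_pi_le) (use y True in auto)
    then have "cos y - 1 / 2 \<ge> 0" by (simp add: cos_60)
    moreover have "((\<lambda>x. sin x - x / 2) has_real_derivative cos y - 1 / 2) (at y)"
      by (auto intro!: derivative_eq_intros)
    ultimately show "\<exists>d. ((\<lambda>x. sin x - x / 2) has_real_derivative d) (at y) \<and> 0 \<le> d" by blast
  qed
  then show ?thesis by simp
next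
  case False
  have "sin x \<ge> sin (pi / 3)" by (rule sin_monotone_2pi_le) (use False assms in auto)
  also have "sin (pi / 3) = sqrt 3 / 2" by (rule sin_60)
  finally have "sin x \<ge> sqrt 3 / 2" .
  moreover have "sqrt 3 \<ge> 1.6" by (rule real_le_rsqrt) (simp add: power2_eq_square)
  moreover have "x \<le> 1.6" using assms pi_approx by simp
  ultimately show ?thesis by simp
qed

lemma sin_lower:
  assumes "0 \<le> h" "h \<le> t" "t \<le> pi - h"
  shows "h / 2 \<le> sin t"
proof (cases "t \<le> pi / 2")
  case True
  then show ?thesis using sin_ge_half[of t] assms by simp
next
  case False
  then have "(pi - t) / 2 \<le> sin (pi - t)" using assms by (intro sin_ge_half) auto
  then show ?thesis using assms by simp
qed

definition trig_weight :: "real \<Rightarrow> real \<Rightarrow> real \<Rightarrow> real" where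
  "trig_weight a b t = sin (t / 2) powr a * cos (t / 2) powr b"

definition trig_log_deriv :: "real \<Rightarrow> real \<Rightarrow> real \<Rightarrow> real" where
  "trig_log_deriv a b t = a / 2 * (cos (t / 2) / sin (t / 2)) - b / 2 * (sin (t / 2) / cos (t / 2))"

text \<open>The Liouville normal form of the Jacobi equation: multiplying \<open>P (cos t)\<close> by \<open>trig_weight a b\<close>, with
  \<open>a = \<alpha> + 1/2\<close> and \<open>b = \<beta> + 1/2\<close>, removes the first-order term and leaves this potential;
  \<open>a - a\<^sup>2 = 1/4 - \<alpha>\<^sup>2\<close>.\<close>

definition trig_potential :: "real \<Rightarrow> real \<Rightarrow> real \<Rightarrow> real" where
  "trig_potential a b t = (a - a\<^sup>2) / (4 * (sin (t / 2))\<^sup>2) + (b - b\<^sup>2) / (4 * (cos (t / 2))\<^sup>2)"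

lemma half_angle_pos:
  assumes "0 < t" "t < pi"
  shows "sin (t / 2) > 0" "cos (t / 2) > 0"
  using assms by (auto intro!: sin_gt_zero cos_gt_zero)

lemma half_angle: "sin t = 2 * sin (t / 2) * cos (t / 2)" "cos t = (cos (t / 2))\<^sup>2 - (sin (t / 2))\<^sup>2" for t :: real
  using sin_double[of "t / 2"] cos_double[of "t / 2"] by simp_all

lemma trig_weight_pos: "0 < t \<Longrightarrow> t < pi \<Longrightarrow> trig_weight a b t > 0"
  using half_angle_pos[of t] by (simp add: trig_weight_def)

lemma trig_weight_deriv:
  assumes "0 < t" "t < pi"
  shows "(trig_weight a b has_real_derivative trig_weight a b t * trig_log_deriv a b t) (at t)"
proof -
  note p = half_angle_pos[OF assms]
  have 1: "((\<lambda>t. sin (t / 2) powr a) has_real_derivative a * sin (t / 2) powr (a - 1) * (cos (t / 2) * (1 / 2))) (at t)"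
    using p by (auto intro!: derivative_eq_intros)
  have 2: "((\<lambda>t. cos (t / 2) powr b) has_real_derivative b * cos (t / 2) powr (b - 1) * (- sin (t / 2) * (1 / 2))) (at t)"
    using p by (auto intro!: derivative_eq_intros)
  show ?thesis unfolding trig_weight_def
    by (rule DERIV_cong[OF DERIV_mult[OF 1 2]])
      (use p in \<open>simp add: trig_log_deriv_def powr_diff field_simps\<close>)
qed

lemma trig_log_deriv_deriv:
  assumes "0 < t" "t < pi"
  shows "(trig_log_deriv a b has_real_derivative - a / (4 * (sin (t / 2))\<^sup>2) - b / (4 * (cos (t / 2))\<^sup>2)) (at t)"
proof -
  note p = half_angle_pos[OF assms]
  have s: "((\<lambda>t. sin (t / 2)) has_real_derivative cos (t / 2) / 2) (at t)"
    and c: "((\<lambda>t. cos (t / 2)) has_real_derivative - sin (t / 2) / 2) (at t)"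
    by (auto intro!: derivative_eq_intros)
  have 1: "((\<lambda>t. cos (t / 2) / sin (t / 2)) has_real_derivative - 1 / (2 * (sin (t / 2))\<^sup>2)) (at t)"
  proof (rule DERIV_cong[OF DERIV_divide[OF c s]])
    have e: "(- sin (t / 2) / 2 * sin (t / 2) - cos (t / 2) * (cos (t / 2) / 2)) =
      - ((sin (t / 2))\<^sup>2 + (cos (t / 2))\<^sup>2) / 2"
      by (simp add: power2_eq_square add.commute del: sin_cos_squared_add sin_cos_squared_add2 sin_cos_squared_add3)
    show "(- sin (t / 2) / 2 * sin (t / 2) - cos (t / 2) * (cos (t / 2) / 2)) / (sin (t / 2) * sin (t / 2)) =
        - 1 / (2 * (sin (t / 2))\<^sup>2)" unfolding e sin_cos_squared_add by (simp add: power2_eq_square)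
  qed (use p in auto)
  have 2: "((\<lambda>t. sin (t / 2) / cos (t / 2)) has_real_derivative 1 / (2 * (cos (t / 2))\<^sup>2)) (at t)"
  proof (rule DERIV_cong[OF DERIV_divide[OF s c]])
    have e: "(cos (t / 2) / 2 * cos (t / 2) - sin (t / 2) * (- sin (t / 2) / 2)) =
      ((sin (t / 2))\<^sup>2 + (cos (t / 2))\<^sup>2) / 2"
      by (simp add: power2_eq_square add.commute del: sin_cos_squared_add sin_cos_squared_add2 sin_cos_squared_add3)
    show "(cos (t / 2) / 2 * cos (t / 2) - sin (t / 2) * (- sin (t / 2) / 2)) / (cos (t / 2) * cos (t / 2)) =
        1 / (2 * (cos (t / 2))\<^sup>2)" unfolding e sin_cos_squared_add by (simp add: power2_eq_square)
  qed (use p in auto)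
  show ?thesis unfolding trig_log_deriv_def
    by (rule DERIV_cong[OF DERIV_diff[OF DERIV_cmult[OF 1] DERIV_cmult[OF 2]]])
      (simp add: field_simps)
qed

text \<open>The factor \<open>W = trig_weight a b\<close> has logarithmic derivative \<open>h = trig_log_deriv a b\<close>. Differentiating twice
  produces \<open>W ((h\<^sup>2 + h') P - (2 h sin t + cos t) P' + sin\<^sup>2 t P'')\<close>; \<open>a\<close> and \<open>b\<close> are chosen so that the
  coefficient of \<open>P'\<close> matches the differential equation of \<open>P\<close>.\<close>

lemma trig_weight_ode:
  fixes \<alpha> \<beta> :: real and n :: nat
  defines "a \<equiv> \<alpha> + 1/2" and "b \<equiv> \<beta> + 1/2" and "N \<equiv> real n + (\<alpha> + \<beta> + 1) / 2"
  assumes ode: "jacobi_op \<alpha> \<beta> P = smult (- (real n * (real n + \<alpha> + \<beta> + 1))) P"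
    and t: "0 < t" "t < pi"
  defines "u \<equiv> \<lambda>t. trig_weight a b t * poly P (cos t)"
    and "v \<equiv> \<lambda>t. trig_weight a b t * (trig_log_deriv a b t * poly P (cos t) - sin t * poly (pderiv P) (cos t))"
  shows "(u has_real_derivative v t) (at t)"
    and "(v has_real_derivative - (N\<^sup>2 + trig_potential a b t) * u t) (at t)"
proof -
  have c: "((\<lambda>t. poly Q (cos t)) has_real_derivative poly (pderiv Q) (cos t) * (- sin t)) (at t)" for Q :: "real poly"
    by (rule DERIV_chain2[OF poly_DERIV]) (auto intro!: derivative_eq_intros)
  note W = trig_weight_deriv[OF t, of a b]
  note h = trig_log_deriv_deriv[OF t, of a b]
  show "(u has_real_derivative v t) (at t)"
    unfolding u_def v_def by (rule DERIV_cong[OF DERIV_mult[OF W c]]) (simp add: algebra_simps)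
  let ?S = "sin (t / 2)" and ?C = "cos (t / 2)"
  let ?h = "trig_log_deriv a b t"
  let ?h' = "- a / (4 * ?S\<^sup>2) - b / (4 * ?C\<^sup>2)"
  let ?P = "poly P (cos t)" and ?P' = "poly (pderiv P) (cos t)" and ?P'' = "poly (pderiv (pderiv P)) (cos t)"
  note p = half_angle_pos[OF t]
  have sc: "?S\<^sup>2 + ?C\<^sup>2 = 1" by simp
  have ode': "(sin t)\<^sup>2 * ?P'' = - (\<beta> - \<alpha> - (\<alpha> + \<beta> + 2) * cos t) * ?P' - real n * (real n + \<alpha> + \<beta> + 1) * ?P"
  proof -
    have "poly (jacobi_op \<alpha> \<beta> P) (cos t) = - (real n * (real n + \<alpha> + \<beta> + 1)) * ?P" by (simp add: ode)
    then have "(1 - (cos t)\<^sup>2) * ?P'' = - (\<beta> - \<alpha> - (\<alpha> + \<beta> + 2) * cos t) * ?P' - real n * (real n + \<alpha> + \<beta> + 1) * ?P"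
      unfolding poly_jacobi_op by (simp add: algebra_simps)
    then show ?thesis by (simp add: sin_squared_eq)
  qed
  have first: "2 * ?h * sin t + cos t = - (\<beta> - \<alpha> - (\<alpha> + \<beta> + 2) * cos t)"
  proof -
    have "2 * ?h * sin t = 2 * a * ?C\<^sup>2 - 2 * b * ?S\<^sup>2"
      unfolding half_angle(1)[of t] trig_log_deriv_def using p by (simp add: field_simps power2_eq_square)
    then show ?thesis using sc unfolding half_angle(2)[of t] a_def b_def by algebra
  qed
  have zero: "?h\<^sup>2 + ?h' - real n * (real n + \<alpha> + \<beta> + 1) = - (N\<^sup>2 + trig_potential a b t)"
  proof -
    define p q where "p = 1 / ?S\<^sup>2" and "q = 1 / ?C\<^sup>2"
    have "?h\<^sup>2 = a\<^sup>2 / 4 * (?C\<^sup>2 / ?S\<^sup>2) - a * b / 2 + b\<^sup>2 / 4 * (?S\<^sup>2 / ?C\<^sup>2)"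
      unfolding trig_log_deriv_def using half_angle_pos[OF t] by (simp add: power2_eq_square field_simps)
    also have "?C\<^sup>2 / ?S\<^sup>2 = p - 1"
      unfolding p_def using half_angle_pos[OF t] sc by (simp add: field_simps)
    also have "?S\<^sup>2 / ?C\<^sup>2 = q - 1"
      unfolding q_def using half_angle_pos[OF t] sc by (simp add: field_simps)
    finally have h2: "?h\<^sup>2 = a\<^sup>2 / 4 * (p - 1) - a * b / 2 + b\<^sup>2 / 4 * (q - 1)" .
    have "trig_potential a b t = (a - a\<^sup>2) / 4 * p + (b - b\<^sup>2) / 4 * q" "?h' = - a / 4 * p - b / 4 * q"
      by (simp_all add: trig_potential_def p_def q_def)
    with h2 have "?h\<^sup>2 + ?h' = - trig_potential a b t - (a + b)\<^sup>2 / 4"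
      by (simp add: power2_eq_square field_simps)
    moreover have "N\<^sup>2 = real n * (real n + \<alpha> + \<beta> + 1) + (a + b)\<^sup>2 / 4"
      by (simp add: N_def a_def b_def power2_eq_square field_simps)
    ultimately show ?thesis by simp
  qed
  have "(v has_real_derivative trig_weight a b t * ((?h\<^sup>2 + ?h') * ?P - (2 * ?h * sin t + cos t) * ?P' + (sin t)\<^sup>2 * ?P'')) (at t)"
    unfolding v_def
    by (rule DERIV_cong[OF DERIV_mult[OF W DERIV_diff[OF DERIV_mult[OF h c] DERIV_mult[OF DERIV_sin c]]]])
       algebra
  also have "(?h\<^sup>2 + ?h') * ?P - (2 * ?h * sin t + cos t) * ?P' + (sin t)\<^sup>2 * ?P'' =
     (?h\<^sup>2 + ?h' - real n * (real n + \<alpha> + \<beta> + 1)) * ?P"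
    unfolding first ode' by (simp add: algebra_simps)
  also have "\<dots> = - (N\<^sup>2 + trig_potential a b t) * ?P" unfolding zero ..
  finally show "(v has_real_derivative - (N\<^sup>2 + trig_potential a b t) * u t) (at t)"
    by (simp add: u_def mult_ac)
qed

lemma trig_potential_bound:
  assumes t: "0 < t" "t < pi"
  shows "\<bar>trig_potential a b t\<bar> \<le> (\<bar>a - a\<^sup>2\<bar> + \<bar>b - b\<^sup>2\<bar>) / (sin t)\<^sup>2"
proof -
  note p = half_angle_pos[OF t]
  let ?k = "\<bar>a - a\<^sup>2\<bar> + \<bar>b - b\<^sup>2\<bar>"
  have "\<bar>trig_potential a b t\<bar> \<le> \<bar>a - a\<^sup>2\<bar> / (4 * (sin (t / 2))\<^sup>2) + \<bar>b - b\<^sup>2\<bar> / (4 * (cos (t / 2))\<^sup>2)"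
    unfolding trig_potential_def by (rule order_trans[OF abs_triangle_ineq]) simp
  also have "\<dots> \<le> ?k / (4 * (sin (t / 2))\<^sup>2) + ?k / (4 * (cos (t / 2))\<^sup>2)"
    by (intro add_mono divide_right_mono) auto
  also have "\<dots> = ?k * ((sin (t / 2))\<^sup>2 + (cos (t / 2))\<^sup>2) / (4 * (sin (t / 2))\<^sup>2 * (cos (t / 2))\<^sup>2)"
    using p by (simp add: field_simps del: sin_cos_squared_add sin_cos_squared_add2 sin_cos_squared_add3)
  also have "\<dots> = ?k / (sin t)\<^sup>2"
    by (simp add: half_angle(1)[of t] power_mult_distrib mult_ac)
  finally show ?thesis .
qed

text \<open>As \<open>\<bar>trig_potential a b t\<bar> \<le> k / sin\<^sup>2 t\<close>, a primitive of the bound divided by \<open>N\<close> is \<open>- k/N * cot t\<close>. It is bounded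
  on \<open>[c/N, \<pi> - c/N]\<close> uniformly in \<open>N\<close>, because \<open>sin t \<ge> c/(2N)\<close> there.\<close>

lemma jacobi_energy:
  fixes \<alpha> \<beta> :: real and n :: nat and c :: real
  defines "a \<equiv> \<alpha> + 1/2" and "b \<equiv> \<beta> + 1/2" and "N \<equiv> real n + (\<alpha> + \<beta> + 1) / 2"
  defines "k \<equiv> \<bar>a - a\<^sup>2\<bar> + \<bar>b - b\<^sup>2\<bar>"
  assumes ode: "jacobi_op \<alpha> \<beta> P = smult (- (real n * (real n + \<alpha> + \<beta> + 1))) P"
    and N: "N > 0" and c: "c > 0"
  defines "u \<equiv> \<lambda>t. trig_weight a b t * poly P (cos t)"
    and "v \<equiv> \<lambda>t. trig_weight a b t * (trig_log_deriv a b t * poly P (cos t) - sin t * poly (pderiv P) (cos t))"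
  shows "t \<in> {c/N..pi-c/N} \<Longrightarrow> \<bar>trig_potential a b t\<bar> \<le> 4 * k / c\<^sup>2 * N\<^sup>2"
    and "s \<in> {c/N..pi-c/N} \<Longrightarrow> t \<in> {c/N..pi-c/N} \<Longrightarrow>
      (v s)\<^sup>2 + N\<^sup>2 * (u s)\<^sup>2 \<le> exp (2 * (2 * k / c)) * ((v t)\<^sup>2 + N\<^sup>2 * (u t)\<^sup>2)"
proof -
  have k0: "k \<ge> 0" by (simp add: k_def)
  have cN: "c / N > 0" using c N by simp
  have t0: "0 < t" "t < pi" "sin t \<ge> c / N / 2" "sin t > 0" if "t \<in> {c/N..pi-c/N}" for t
  proof -
    show "0 < t" "t < pi" using that cN by auto
    show "sin t \<ge> c / N / 2" by (rule sin_lower) (use that cN in auto)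
    then show "sin t > 0" using half_gt_zero[OF cN] by (rule less_le_trans[rotated])
  qed
  show "\<bar>trig_potential a b t\<bar> \<le> 4 * k / c\<^sup>2 * N\<^sup>2" if t: "t \<in> {c/N..pi-c/N}" for t
  proof -
    have "\<bar>trig_potential a b t\<bar> \<le> k / (sin t)\<^sup>2" unfolding k_def by (rule trig_potential_bound) (use t0[OF t] in auto)
    also have "\<dots> \<le> k / (c / N / 2)\<^sup>2"
      using t0[OF t] half_gt_zero[OF cN] k0
        by (intro divide_left_mono power_mono mult_pos_pos zero_less_power) (assumption | linarith)+
    also have "\<dots> = 4 * k / c\<^sup>2 * N\<^sup>2" using c N by (simp add: field_simps power2_eq_square)
    finally show ?thesis .
  qed
  define \<phi> where "\<phi> = (\<lambda>t. k / N / (sin t)\<^sup>2)"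
  define \<Phi> where "\<Phi> = (\<lambda>t. - (k / N) * (cos t / sin t))"
  show "(v s)\<^sup>2 + N\<^sup>2 * (u s)\<^sup>2 \<le> exp (2 * (2 * k / c)) * ((v t)\<^sup>2 + N\<^sup>2 * (u t)\<^sup>2)"
    if st: "s \<in> {c/N..pi-c/N}" "t \<in> {c/N..pi-c/N}" for s t
  proof (rule energy_comparison[where a = "c/N" and b = "pi - c/N" and g = "trig_potential a b" and \<phi> = \<phi> and \<Phi> = \<Phi>])
    fix t assume t: "t \<in> {c/N..pi-c/N}"
    note t0 = t0[OF t]
    show "(u has_real_derivative v t) (at t)"
      unfolding u_def v_def a_def b_def by (rule trig_weight_ode(1)[OF ode t0(1,2)])
    show "(v has_real_derivative - (N\<^sup>2 + trig_potential a b t) * u t) (at t)"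
      unfolding u_def v_def a_def b_def N_def by (rule trig_weight_ode(2)[OF ode t0(1,2)])
    have "((\<lambda>t. cos t / sin t) has_real_derivative - 1 / (sin t)\<^sup>2) (at t)"
    proof (rule DERIV_cong[OF DERIV_divide[OF DERIV_cos DERIV_sin]])
      have e: "- sin t * sin t - cos t * cos t = - (cos t * cos t + sin t * sin t)"
        by (simp del: sin_cos_squared_add3)
      show "(- sin t * sin t - cos t * cos t) / (sin t * sin t) = - 1 / (sin t)\<^sup>2"
        unfolding e sin_cos_squared_add3 by (simp add: power2_eq_square)
    qed (use t0 in auto)
    from DERIV_cmult[OF this, of "- (k / N)"] show "(\<Phi> has_real_derivative \<phi> t) (at t)"
      unfolding \<Phi>_def \<phi>_def by simp
    show "\<bar>trig_potential a b t\<bar> \<le> N * \<phi> t"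
      using trig_potential_bound[OF t0(1,2), of a b] N by (simp add: \<phi>_def k_def)
    have "\<bar>\<Phi> t\<bar> = k / N * (\<bar>cos t\<bar> / sin t)" using t0 k0 N by (simp add: \<Phi>_def abs_mult)
    also have "\<dots> \<le> k / N * (1 / (c / N / 2))"
      using t0 cN k0 N by (intro mult_left_mono frac_le) auto
    also have "\<dots> = 2 * k / c" using c N by (simp add: field_simps)
    finally show "\<bar>\<Phi> t\<bar> \<le> 2 * k / c" .
  qed (use N st in auto)
qed

lemma abs_sin_diff_le: "\<bar>sin x - sin y\<bar> \<le> \<bar>x - y\<bar>" for x y :: real
proof -
  have "\<bar>sin x - sin y\<bar> = 2 * \<bar>sin ((x - y) / 2)\<bar> * \<bar>cos ((x + y) / 2)\<bar>"
    unfolding sin_diff_sin by (simp add: abs_mult)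
  also have "\<dots> \<le> 2 * \<bar>(x - y) / 2\<bar> * 1"
    by (intro mult_mono mult_left_mono abs_sin_x_le_abs_x) auto
  finally show ?thesis by simp
qed

text \<open>Here \<open>A = sin (s/2) / sin (t/2)\<close> and \<open>B = cos (s/2) / cos (t/2)\<close> compare the weights at two angles.
  Since \<open>S\<^sup>2 + C\<^sup>2 = (A S)\<^sup>2 + (B C)\<^sup>2\<close>, one ratio is at least 1 and the other at most 1. The harmonic mean is at
  most twice the smaller ratio, which compensates a negative power of it as \<open>a, b > -1\<close>. Thus only the power of
  the larger ratio remains, and one never pays for both end points at once.\<close>

lemma ratio_bound:
  fixes a b \<gamma> A B S C :: real
  assumes ab: "a > -1" "b > -1" and \<gamma>: "\<gamma> \<ge> 0" "a \<le> \<gamma>" "b \<le> \<gamma>" and pos: "A > 0" "B > 0"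
    and SC: "S > 0" "C > 0" "S\<^sup>2 + C\<^sup>2 = 1" "(A * S)\<^sup>2 + (B * C)\<^sup>2 = 1"
    and X: "A \<le> X" "B \<le> X" "1 \<le> X"
  shows "A powr a * B powr b * (2 * A * B / (A + B)) \<le> 2 * X powr \<gamma>"
proof -
  have main: "A powr a * B powr b * (2 * A * B / (A + B)) \<le> 2 * X powr \<gamma>"
    if "A \<ge> 1" "B \<le> 1" "a \<le> \<gamma>" "b > -1" "A > 0" "B > 0" "A \<le> X" for a b A B :: real
  proof -
    have "A powr a * B powr b * (2 * A * B / (A + B)) = 2 * A powr a * B powr (b + 1) * (A / (A + B))"
      using that by (simp add: powr_add)
    also have "\<dots> \<le> 2 * A powr a * B powr (b + 1) * 1"
      using that by (intro mult_left_mono) auto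
    also have "\<dots> \<le> 2 * X powr \<gamma> * 1 * 1"
    proof (intro mult_mono)
      have "A powr a \<le> A powr \<gamma>" using that by (intro powr_mono) auto
      also have "\<dots> \<le> X powr \<gamma>" using that \<gamma> by (intro powr_mono2) auto
      finally show "A powr a \<le> X powr \<gamma>" .
      show "B powr (b + 1) \<le> 1" using that by (intro powr_le1) auto
    qed auto
    finally show ?thesis by simp
  qed
  show ?thesis
  proof (cases "A \<ge> 1")
    case True
    have "B \<le> 1"
    proof (rule ccontr)
      assume B: "\<not> B \<le> 1"
      have "1 * S\<^sup>2 \<le> A\<^sup>2 * S\<^sup>2" using True by (intro mult_right_mono) auto
      moreover have "1 * C\<^sup>2 < B\<^sup>2 * C\<^sup>2" using B SC(2) by (intro mult_strict_right_mono) (auto simp: one_less_power)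
      ultimately show False using SC(3,4) by (simp add: power_mult_distrib)
    qed
    then show ?thesis using main[of A B a b] True assms by simp
  next
    case False
    have "B \<ge> 1"
    proof (rule ccontr)
      assume B: "\<not> B \<ge> 1"
      have "A\<^sup>2 * S\<^sup>2 < 1 * S\<^sup>2" "B\<^sup>2 * C\<^sup>2 < 1 * C\<^sup>2"
        using False B pos SC(1,2) by (intro mult_strict_right_mono; simp add: abs_square_less_1)+
      then show False using SC(3,4) by (simp add: power_mult_distrib)
    qed
    then show ?thesis using main[of B A b a] False assms by (simp add: mult_ac add.commute)
  qed
qed

section \<open>Sums over separated points\<close>

lemma sum_powr_bound:
  assumes "0 < \<gamma>" "\<gamma> \<le> 1"
  shows "(\<Sum>j<M. (1 + real j) powr (\<gamma> - 1)) \<le> real M powr \<gamma> / \<gamma>"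
proof (induction M)
  case 0 then show ?case by simp
next
  case (Suc M)
  have "(1 + real M) powr (\<gamma> - 1) \<le> (real (Suc M) powr \<gamma> - real M powr \<gamma>) / \<gamma>"
  proof -
    have cont: "continuous_on {real M..real (Suc M)} (\<lambda>x. x powr \<gamma>)"
      by (rule continuous_on_powr') (use assms in \<open>auto intro!: continuous_intros\<close>)
    have "\<exists>\<xi>. real M < \<xi> \<and> \<xi> < real (Suc M) \<and> real (Suc M) powr \<gamma> - real M powr \<gamma> = (\<gamma> * \<xi> powr (\<gamma> - 1)) * (real (Suc M) - real M)"
    proof -
      obtain \<xi> where "real M < \<xi>" "\<xi> < real (Suc M)"
        "real (Suc M) powr \<gamma> - real M powr \<gamma> = (\<lambda>h. (\<gamma> * \<xi> powr (\<gamma> - 1)) * h) (real (Suc M) - real M)"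
      proof (rule mvt[OF _ cont])
        fix x :: real assume "real M < x" "x < real (Suc M)"
        then have "((\<lambda>x. x powr \<gamma>) has_real_derivative \<gamma> * x powr (\<gamma> - 1)) (at x)"
          by (intro has_real_derivative_powr) simp
        then show "((\<lambda>x. x powr \<gamma>) has_derivative (\<lambda>h. \<gamma> * x powr (\<gamma> - 1) * h)) (at x)"
          by (simp add: has_field_derivative_def)
      qed auto
      then show ?thesis by blast
    qed
    then obtain \<xi> where \<xi>: "real M < \<xi>" "\<xi> < real (Suc M)"
       "real (Suc M) powr \<gamma> - real M powr \<gamma> = \<gamma> * \<xi> powr (\<gamma> - 1)" by auto
    have "(1 + real M) powr (\<gamma> - 1) \<le> \<xi> powr (\<gamma> - 1)"
      by (rule powr_mono2') (use \<xi> assms in auto)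
    then show ?thesis using \<xi>(3) assms by simp
  qed
  then show ?case using Suc by (simp add: diff_divide_distrib)
qed

lemma sum_inverse_bound:
  "M > 0 \<Longrightarrow> (\<Sum>j<M. (1 + real j) powr (0 - 1)) \<le> 1 + ln (real M)"
proof (induction M rule: nat_induct_non_zero)
  case 1 then show ?case by simp
next
  case (Suc M)
  have "ln (real M / (1 + real M)) \<le> real M / (1 + real M) - 1"
    by (rule ln_le_minus_one) (use Suc in auto)
  then have "1 / (1 + real M) \<le> ln (1 + real M) - ln (real M)"
    using Suc by (simp add: ln_div field_simps)
  then show ?case using Suc by (simp add: powr_minus_divide add.commute)
qed

text \<open>Points that are \<open>\<delta>\<close> apart fall into different cells of width \<open>\<delta>\<close>. Numbering the cells by integers
  \<open>m\<close> from \<open>\<tau>\<close>, a point in cell \<open>m\<close> satisfies \<open>1 + \<bar>s - \<tau>\<bar> \<ge> \<delta>/2 * (1 + \<bar>m\<bar>)\<close>, and the exponent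
  \<open>\<gamma> - 1\<close> is not positive.\<close>

lemma separated_sum:
  fixes T :: "real set"
  assumes T: "finite T" "\<And>s s'. s \<in> T \<Longrightarrow> s' \<in> T \<Longrightarrow> s \<noteq> s' \<Longrightarrow> \<delta> \<le> \<bar>s - s'\<bar>"
    and \<delta>: "0 < \<delta>" "\<delta> \<le> 1/2" and \<gamma>: "\<gamma> \<le> 1"
    and M: "\<And>s. s \<in> T \<Longrightarrow> \<bar>s - \<tau>\<bar> / \<delta> + 2 \<le> real M"
  shows "(\<Sum>s\<in>T. (1 + \<bar>s - \<tau>\<bar>) powr (\<gamma> - 1)) \<le> (\<delta> / 2) powr (\<gamma> - 1) * (2 * (\<Sum>j<M. (1 + real j) powr (\<gamma> - 1)))"
proof -
  define f where "f = (\<lambda>s. \<lfloor>(s - \<tau>) / \<delta>\<rfloor>)"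
  have f1: "real_of_int (f s) * \<delta> \<le> s - \<tau>" "s - \<tau> < (real_of_int (f s) + 1) * \<delta>" for s
  proof -
    have "real_of_int (f s) \<le> (s - \<tau>) / \<delta>" "(s - \<tau>) / \<delta> < real_of_int (f s) + 1" by (auto simp: f_def)
    then show "real_of_int (f s) * \<delta> \<le> s - \<tau>" "s - \<tau> < (real_of_int (f s) + 1) * \<delta>"
      using \<delta> by (simp_all add: field_simps)
  qed
  have inj: "inj_on f T"
  proof (rule inj_onI, rule ccontr)
    fix s s' assume h: "s \<in> T" "s' \<in> T" "f s = f s'" "s \<noteq> s'"
    have "\<bar>s - s'\<bar> < \<delta>"
      using f1[of s] f1[of s'] h(3) by (simp add: abs_less_iff algebra_simps)
    then show False using T(2)[OF h(1,2,4)] by simp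
  qed
  have lb: "\<delta> / 2 * (1 + \<bar>real_of_int (f s)\<bar>) \<le> 1 + \<bar>s - \<tau>\<bar>" for s
  proof (cases "f s \<ge> 0")
    case True
    then have "\<delta> / 2 * (1 + \<bar>real_of_int (f s)\<bar>) = \<delta> / 2 + real_of_int (f s) * \<delta> / 2" by (simp add: algebra_simps)
    also have "\<dots> \<le> 1 + real_of_int (f s) * \<delta>"
    proof -
      have "real_of_int (f s) * \<delta> \<ge> 0" using True \<delta> by simp
      then show ?thesis using \<delta> by linarith
    qed
    finally show ?thesis using f1(1)[of s] by linarith
  next
    case False
    then have neg: "- real_of_int (f s) - 1 \<ge> 0" by linarith
    have "\<delta> / 2 * (1 + \<bar>real_of_int (f s)\<bar>) = \<delta> + (- real_of_int (f s) - 1) * \<delta> / 2" using False by (simp add: field_simps)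
    also have "\<dots> \<le> 1 + (- real_of_int (f s) - 1) * \<delta>"
    proof -
      have "(- real_of_int (f s) - 1) * \<delta> \<ge> 0" using neg \<delta> by simp
      then show ?thesis using \<delta> by linarith
    qed
    also have "\<dots> \<le> 1 + \<bar>s - \<tau>\<bar>" using f1(2)[of s] by (simp add: algebra_simps)
    finally show ?thesis .
  qed
  have fr: "\<bar>f s\<bar> \<le> int M - 1" if "s \<in> T" for s
  proof -
    have "\<bar>real_of_int (f s)\<bar> \<le> \<bar>s - \<tau>\<bar> / \<delta> + 1"
    proof -
      have "\<bar>real_of_int (f s)\<bar> \<le> \<bar>(s - \<tau>) / \<delta>\<bar> + 1" unfolding f_def by linarith
      then show ?thesis using \<delta> by simp
    qed
    also have "\<dots> \<le> real M - 1" using M[OF that] by simp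
    finally have "real_of_int \<bar>f s\<bar> \<le> real_of_int (int M - 1)" by simp
    then show ?thesis by (simp only: of_int_le_iff)
  qed
  let ?g = "\<lambda>m::int. (1 + \<bar>real_of_int m\<bar>) powr (\<gamma> - 1)"
  let ?A = "int ` {..<M}" and ?B = "(\<lambda>j. - int j) ` {..<M}"
  have "(\<Sum>s\<in>T. (1 + \<bar>s - \<tau>\<bar>) powr (\<gamma> - 1)) \<le> (\<Sum>s\<in>T. (\<delta> / 2) powr (\<gamma> - 1) * ?g (f s))"
  proof (rule sum_mono)
    fix s assume "s \<in> T"
    have "(1 + \<bar>s - \<tau>\<bar>) powr (\<gamma> - 1) \<le> (\<delta> / 2 * (1 + \<bar>real_of_int (f s)\<bar>)) powr (\<gamma> - 1)"
      by (rule powr_mono2') (use lb[of s] \<delta> \<gamma> in auto)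
    also have "\<dots> = (\<delta> / 2) powr (\<gamma> - 1) * ?g (f s)" using \<delta> by (subst powr_mult) auto
    finally show "(1 + \<bar>s - \<tau>\<bar>) powr (\<gamma> - 1) \<le> (\<delta> / 2) powr (\<gamma> - 1) * ?g (f s)" .
  qed
  also have "\<dots> = (\<delta> / 2) powr (\<gamma> - 1) * (\<Sum>m\<in>f ` T. ?g m)"
    by (simp add: sum.reindex[OF inj] sum_distrib_left)
  also have "\<dots> \<le> (\<delta> / 2) powr (\<gamma> - 1) * (\<Sum>m\<in>?A \<union> ?B. ?g m)"
  proof (intro mult_left_mono sum_mono2)
    show "f ` T \<subseteq> ?A \<union> ?B"
    proof
      fix m assume "m \<in> f ` T"
      then have "\<bar>m\<bar> \<le> int M - 1" using fr by auto
      then have "nat \<bar>m\<bar> < M" by linarith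
      then show "m \<in> ?A \<union> ?B"
        by (cases "m \<ge> 0") (auto intro!: image_eqI[of _ _ "nat \<bar>m\<bar>"])
    qed
  qed auto
  also have "\<dots> \<le> (\<delta> / 2) powr (\<gamma> - 1) * ((\<Sum>m\<in>?A. ?g m) + (\<Sum>m\<in>?B. ?g m))"
    by (intro mult_left_mono) (auto simp: sum_Un intro!: sum_nonneg)
  also have "(\<Sum>m\<in>?A. ?g m) = (\<Sum>j<M. (1 + real j) powr (\<gamma> - 1))"
    by (subst sum.reindex) (auto simp: inj_on_def)
  also have "(\<Sum>m\<in>?B. ?g m) = (\<Sum>j<M. (1 + real j) powr (\<gamma> - 1))"
    by (subst sum.reindex) (auto simp: inj_on_def)
  finally show ?thesis by simp
qed

definition rate :: "real \<Rightarrow> nat \<Rightarrow> real" where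
  "rate \<gamma> n = (if \<gamma> > 0 then real n powr \<gamma> else ln (real n))"

lemma rate_nonneg: "n \<ge> 1 \<Longrightarrow> rate \<gamma> n \<ge> 0"
  by (simp add: rate_def)

text \<open>For \<open>\<gamma> > 1\<close> the summands increase with the distance, and the number of points times the largest possible
  summand is already of the right order. Otherwise the cells reduce the sum to \<open>\<Sum> j powr (\<gamma> - 1)\<close> over
  \<open>O(n)\<close> integers \<open>j\<close>.\<close>

lemma separated_sum_rate:
  fixes \<gamma> \<delta> A :: real
  assumes \<gamma>: "\<gamma> \<ge> 0" and \<delta>: "0 < \<delta>" "\<delta> \<le> 1/2" and A: "A > 0"
  obtains C where "C \<ge> 0" and "\<And>n T \<tau>. n \<ge> 2 \<Longrightarrow> finite T \<Longrightarrow> card T \<le> n \<Longrightarrow>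
      (\<And>s s'. s \<in> T \<Longrightarrow> s' \<in> T \<Longrightarrow> s \<noteq> s' \<Longrightarrow> \<delta> \<le> \<bar>s - s'\<bar>) \<Longrightarrow>
      (\<And>s. s \<in> T \<Longrightarrow> \<bar>s - \<tau>\<bar> \<le> A * real n) \<Longrightarrow>
      (\<Sum>s\<in>T. (1 + \<bar>s - \<tau>\<bar>) powr (\<gamma> - 1)) \<le> C * rate \<gamma> n"
proof -
  define B where "B = A / \<delta> + 3"
  have B: "B \<ge> 3" using A \<delta> by (simp add: B_def)
  have M_exists: "\<exists>M::nat. y + 2 \<le> real M \<and> real M \<le> y + 3" if "y \<ge> 0" for y :: real
  proof -
    have "0 \<le> \<lceil>y + 2\<rceil>" using that by linarith
    then have "real (nat \<lceil>y + 2\<rceil>) = real_of_int \<lceil>y + 2\<rceil>" by simp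
    then show ?thesis by (intro exI[of _ "nat \<lceil>y + 2\<rceil>"]) linarith
  qed
  consider "\<gamma> > 1" | "0 < \<gamma>" "\<gamma> \<le> 1" | "\<gamma> = 0" using \<gamma> by linarith
  then show thesis
  proof cases
    case 1
    show thesis
    proof (rule that[of "(1 + A) powr (\<gamma> - 1)"])
      fix n :: nat and T \<tau>
      assume n: "n \<ge> 2" and T: "finite T" "card T \<le> n" and *: "\<And>s. s \<in> T \<Longrightarrow> \<bar>s - \<tau>\<bar> \<le> A * real n"
      have "(\<Sum>s\<in>T. (1 + \<bar>s - \<tau>\<bar>) powr (\<gamma> - 1)) \<le> (\<Sum>s\<in>T. ((1 + A) * real n) powr (\<gamma> - 1))"
      proof (intro sum_mono powr_mono2)
        fix s assume "s \<in> T"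
        from *[OF this] show "1 + \<bar>s - \<tau>\<bar> \<le> (1 + A) * real n" using n by (simp add: algebra_simps)
      qed (use 1 in auto)
      also have "\<dots> = real (card T) * ((1 + A) * real n) powr (\<gamma> - 1)" by simp
      also have "\<dots> \<le> real n * ((1 + A) * real n) powr (\<gamma> - 1)" using T by (intro mult_right_mono) auto
      also have "\<dots> = (1 + A) powr (\<gamma> - 1) * (real n powr 1 * real n powr (\<gamma> - 1))"
        using A n by (subst powr_mult) auto
      also have "\<dots> = (1 + A) powr (\<gamma> - 1) * rate \<gamma> n"
        unfolding powr_add[symmetric] using 1 by (simp add: rate_def)
      finally show "(\<Sum>s\<in>T. (1 + \<bar>s - \<tau>\<bar>) powr (\<gamma> - 1)) \<le> (1 + A) powr (\<gamma> - 1) * rate \<gamma> n" .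
    qed simp
  next
    case 2
    show thesis
    proof (rule that[of "(\<delta> / 2) powr (\<gamma> - 1) * (2 * (B powr \<gamma> / \<gamma>))"])
      fix n :: nat and T \<tau>
      assume n: "n \<ge> 2" and T: "finite T" "card T \<le> n" "\<And>s s'. s \<in> T \<Longrightarrow> s' \<in> T \<Longrightarrow> s \<noteq> s' \<Longrightarrow> \<delta> \<le> \<bar>s - s'\<bar>"
        and *: "\<And>s. s \<in> T \<Longrightarrow> \<bar>s - \<tau>\<bar> \<le> A * real n"
      obtain M where M1: "A * real n / \<delta> + 2 \<le> real M" and M3: "real M \<le> A * real n / \<delta> + 3"
        using M_exists[of "A * real n / \<delta>"] A \<delta> by auto
      have M2: "real M \<le> B * real n"
      proof -
        have "real M \<le> A * real n / \<delta> + 3" by (rule M3)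
        also have "\<dots> \<le> B * real n" using n unfolding B_def by (simp add: algebra_simps)
        finally show ?thesis .
      qed
      have "(\<Sum>s\<in>T. (1 + \<bar>s - \<tau>\<bar>) powr (\<gamma> - 1)) \<le>
          (\<delta> / 2) powr (\<gamma> - 1) * (2 * (\<Sum>j<M. (1 + real j) powr (\<gamma> - 1)))"
      proof (rule separated_sum[OF T(1) T(3) \<delta> 2(2)])
        fix s assume "s \<in> T"
        then have "\<bar>s - \<tau>\<bar> / \<delta> \<le> A * real n / \<delta>" using * \<delta> by (intro divide_right_mono) auto
        then show "\<bar>s - \<tau>\<bar> / \<delta> + 2 \<le> real M" using M1 by linarith
      qed auto
      also have "\<dots> \<le> (\<delta> / 2) powr (\<gamma> - 1) * (2 * (real M powr \<gamma> / \<gamma>))"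
        using sum_powr_bound[OF 2, of M] by (intro mult_left_mono) auto
      also have "\<dots> \<le> (\<delta> / 2) powr (\<gamma> - 1) * (2 * ((B * real n) powr \<gamma> / \<gamma>))"
        using M2 2 by (intro mult_left_mono divide_right_mono powr_mono2) auto
      also have "\<dots> = (\<delta> / 2) powr (\<gamma> - 1) * (2 * (B powr \<gamma> / \<gamma>)) * rate \<gamma> n"
        using 2 B by (simp add: rate_def powr_mult)
      finally show "(\<Sum>s\<in>T. (1 + \<bar>s - \<tau>\<bar>) powr (\<gamma> - 1)) \<le> (\<delta> / 2) powr (\<gamma> - 1) * (2 * (B powr \<gamma> / \<gamma>)) * rate \<gamma> n" .
    qed (use 2 in simp)
  next
    case 3
    \<comment> \<open>As \<open>n \<ge> 2\<close>, additive constants are absorbed by \<open>ln n \<ge> ln 2\<close>.\<close>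
    define C where "C = (1 + ln B) / ln 2 + 1"
    have C: "C \<ge> 0" using B by (simp add: C_def)
    show thesis
    proof (rule that[of "(\<delta> / 2) powr (\<gamma> - 1) * (2 * C)"])
      fix n :: nat and T \<tau>
      assume n: "n \<ge> 2" and T: "finite T" "card T \<le> n" "\<And>s s'. s \<in> T \<Longrightarrow> s' \<in> T \<Longrightarrow> s \<noteq> s' \<Longrightarrow> \<delta> \<le> \<bar>s - s'\<bar>"
        and *: "\<And>s. s \<in> T \<Longrightarrow> \<bar>s - \<tau>\<bar> \<le> A * real n"
      obtain M where M1: "A * real n / \<delta> + 2 \<le> real M" and M3: "real M \<le> A * real n / \<delta> + 3"
        using M_exists[of "A * real n / \<delta>"] A \<delta> by auto
      have "A * real n / \<delta> \<ge> 0" using A \<delta> by simp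
      then have M0: "M > 0" using M1 by (cases M) auto
      have M2: "real M \<le> B * real n"
      proof -
        have "real M \<le> A * real n / \<delta> + 3" by (rule M3)
        also have "\<dots> \<le> B * real n" using n unfolding B_def by (simp add: algebra_simps)
        finally show ?thesis .
      qed
      have "(\<Sum>s\<in>T. (1 + \<bar>s - \<tau>\<bar>) powr (\<gamma> - 1)) \<le>
          (\<delta> / 2) powr (\<gamma> - 1) * (2 * (\<Sum>j<M. (1 + real j) powr (\<gamma> - 1)))"
      proof (rule separated_sum[OF T(1) T(3) \<delta>])
        fix s assume "s \<in> T"
        then have "\<bar>s - \<tau>\<bar> / \<delta> \<le> A * real n / \<delta>" using * \<delta> by (intro divide_right_mono) auto
        then show "\<bar>s - \<tau>\<bar> / \<delta> + 2 \<le> real M" using M1 by linarith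
      qed (use 3 in auto)
      also have "\<dots> \<le> (\<delta> / 2) powr (\<gamma> - 1) * (2 * (1 + ln (real M)))"
        using sum_inverse_bound[OF M0] 3 by (intro mult_left_mono) auto
      also have "1 + ln (real M) \<le> C * ln (real n)"
      proof -
        have "ln (real M) \<le> ln (B * real n)" using M0 M2 by (subst ln_le_cancel_iff) auto
        also have "\<dots> = ln B + ln (real n)" using B n by (simp add: ln_mult)
        finally have "1 + ln (real M) \<le> (1 + ln B) * 1 + ln (real n)" by simp
        also have "\<dots> \<le> (1 + ln B) * (ln (real n) / ln 2) + ln (real n)"
          using n B by (intro add_right_mono mult_left_mono) auto
        also have "\<dots> = C * ln (real n)" by (simp add: C_def algebra_simps)
        finally show ?thesis .
      qed
      then have "(\<delta> / 2) powr (\<gamma> - 1) * (2 * (1 + ln (real M))) \<le> (\<delta> / 2) powr (\<gamma> - 1) * (2 * (C * ln (real n)))"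
        by (intro mult_left_mono) auto
      finally show "(\<Sum>s\<in>T. (1 + \<bar>s - \<tau>\<bar>) powr (\<gamma> - 1)) \<le> (\<delta> / 2) powr (\<gamma> - 1) * (2 * C) * rate \<gamma> n"
        using 3 by (simp add: rate_def)
    qed (use C in simp)
  qed
qed

section \<open>The univariate Lebesgue function\<close>

text \<open>Put \<open>W = trig_weight a b\<close>, \<open>d = \<bar>\<theta> - s\<bar>\<close> and \<open>Z = sin ((\<theta> + s)/2)\<close>. By hypothesis the basis polynomial is at most
  \<open>e * min (1/N) d * (W s / W \<theta>) * sin s / \<bar>cos \<theta> - cos s\<bar>\<close>. The difference of cosines is at least
  \<open>Z d / 2\<close>, and \<open>sin s / Z\<close> is exactly the harmonic mean \<open>2 A B / (A + B)\<close> of \<open>ratio_bound\<close>; both ratios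
  are at most \<open>1 + O(N d)\<close>, since \<open>\<theta>\<close> stays \<open>c/N\<close> away from \<open>0\<close> and \<open>\<pi>\<close>.\<close>

lemma lagrange_pointwise:
  fixes a b \<gamma> c N \<theta> s e :: real
  assumes ab: "a > -1" "b > -1" and \<gamma>: "\<gamma> \<ge> 0" "a \<le> \<gamma>" "b \<le> \<gamma>"
    and c: "0 < c" "c \<le> 1" and N: "N > 0" and e: "e \<ge> 1"
    and \<theta>: "\<theta> \<in> {c/N..pi - c/N}" and s: "s \<in> {c/N..pi - c/N}"
    and root: "poly P (cos s) = 0" "poly (pderiv P) (cos s) \<noteq> 0"
    and bound: "\<bar>trig_weight a b \<theta> * poly P (cos \<theta>)\<bar> \<le>
      e * \<bar>trig_weight a b s * (sin s * poly (pderiv P) (cos s))\<bar> * min (1 / N) \<bar>\<theta> - s\<bar>"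
  shows "\<bar>poly (lagrange_basis P (cos s)) (cos \<theta>)\<bar> \<le> 8 * e * (2 / c) powr \<gamma> * (1 + \<bar>N * s - N * \<theta>\<bar>) powr (\<gamma> - 1)"
proof (cases "s = \<theta>")
  case True
  have "1 \<le> (2 / c) powr \<gamma>" by (rule ge_one_powr_ge_zero) (use c \<gamma> in auto)
  then have "1 * 1 \<le> (8 * e) * (2 / c) powr \<gamma>" using e by (intro mult_mono) auto
  then show ?thesis using True lagrange_basis_self[OF root] by simp
next
  case False
  define d where "d = \<bar>\<theta> - s\<bar>"
  have d: "d > 0" using False by (simp add: d_def)
  have cN: "c / N > 0" using c N by simp
  have range: "0 < \<theta>" "\<theta> < pi" "0 < s" "s < pi" using \<theta> s cN by auto
  note pt = half_angle_pos[OF range(1,2)] and ps = half_angle_pos[OF range(3,4)]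
  note wt = trig_weight_pos[OF range(1,2), of a b] and ws = trig_weight_pos[OF range(3,4), of a b]
  have ss: "sin s > 0" using range by (intro sin_gt_zero)
  define L where "L = \<bar>poly (lagrange_basis P (cos s)) (cos \<theta>)\<bar>"
  define D where "D = \<bar>cos \<theta> - cos s\<bar>"
  define p' where "p' = \<bar>poly (pderiv P) (cos s)\<bar>"
  have p': "p' > 0" using root by (simp add: p'_def)
  have D: "D > 0" unfolding D_def using False range cos_inj_pi[of \<theta> s] by auto
  have LD: "L * (p' * D) = \<bar>poly P (cos \<theta>)\<bar>"
    using lagrange_basis_mult[OF root, of "cos \<theta>"] by (simp add: L_def p'_def D_def flip: abs_mult)
  have "trig_weight a b \<theta> * (L * (p' * D)) \<le> e * (trig_weight a b s * (sin s * p')) * min (1 / N) d"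
    using bound wt ws ss unfolding LD d_def by (simp add: abs_mult p'_def)
  then have "p' * (trig_weight a b \<theta> * L * D) \<le> p' * (e * (trig_weight a b s * sin s) * min (1 / N) d)"
    by (simp add: mult_ac)
  then have 1: "trig_weight a b \<theta> * L * D \<le> e * (trig_weight a b s * sin s) * min (1 / N) d"
    using p' by (simp only: mult_le_cancel_left_pos)
  define A where "A = sin (s / 2) / sin (\<theta> / 2)"
  define B where "B = cos (s / 2) / cos (\<theta> / 2)"
  define X where "X = 2 / c * (1 + N * d)"
  have AB: "A > 0" "B > 0" using pt ps by (auto simp: A_def B_def)
  have X1: "1 + 2 * N * d / c \<le> X" using c by (simp add: X_def field_simps)
  have Xge: "1 + d / (2 * z) \<le> X" if "z \<ge> c / N / 4" for z
  proof -
    have p: "c / N / 4 > 0" using cN by simp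
    then have "z > 0" using that by linarith
    then have "0 < 2 * z * (2 * (c / N / 4))" using p by (intro mult_pos_pos) auto
    then have "d / (2 * z) \<le> d / (2 * (c / N / 4))"
      by (intro divide_left_mono) (use that d in auto)
    also have "\<dots> = 2 * N * d / c" using c N by (simp add: field_simps)
    finally show ?thesis using X1 by linarith
  qed
  have AX: "A \<le> X"
  proof -
    have "sin (s / 2) \<le> sin (\<theta> / 2) + d / 2"
      using abs_sin_diff_le[of "s / 2" "\<theta> / 2"] unfolding d_def by argo
    then have "A \<le> (sin (\<theta> / 2) + d / 2) / sin (\<theta> / 2)"
      unfolding A_def using pt by (intro divide_right_mono) auto
    also have "\<dots> = 1 + d / (2 * sin (\<theta> / 2))" using pt by (simp add: field_simps)
    also have "\<dots> \<le> X"
    proof (rule Xge)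
      show "sin (\<theta> / 2) \<ge> c / N / 4" using sin_ge_half[of "\<theta> / 2"] range \<theta> by simp
    qed
    finally show ?thesis .
  qed
  have BX: "B \<le> X"
  proof -
    have cs: "cos y = sin (pi / 2 - y)" for y :: real by (simp add: cos_sin_eq)
    have "cos (s / 2) \<le> cos (\<theta> / 2) + d / 2"
      using abs_sin_diff_le[of "pi / 2 - s / 2" "pi / 2 - \<theta> / 2"]
      unfolding d_def cs by argo
    then have "B \<le> (cos (\<theta> / 2) + d / 2) / cos (\<theta> / 2)"
      unfolding B_def using pt by (intro divide_right_mono) auto
    also have "\<dots> = 1 + d / (2 * cos (\<theta> / 2))" using pt by (simp add: field_simps)
    also have "\<dots> \<le> X"
    proof (rule Xge)
      show "cos (\<theta> / 2) \<ge> c / N / 4"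
        using sin_ge_half[of "pi / 2 - \<theta> / 2"] range \<theta> by (simp add: cos_sin_eq)
    qed
    finally show ?thesis .
  qed
  have X1': "1 \<le> X" using Xge[of 1] X1 N d c by (smt (verit) divide_nonneg_pos mult_nonneg_nonneg)
  define Z where "Z = sin ((\<theta> + s) / 2)"
  have Z: "Z = sin (\<theta> / 2) * cos (s / 2) + cos (\<theta> / 2) * sin (s / 2)"
    unfolding Z_def add_divide_distrib sin_add by simp
  have Z0: "Z > 0" unfolding Z using pt ps by (simp add: add_pos_pos)
  have e1: "trig_weight a b s = trig_weight a b \<theta> * (A powr a * B powr b)"
    using pt ps by (simp add: trig_weight_def A_def B_def powr_divide)
  have e2: "sin s = Z * (2 * A * B / (A + B))"
  proof -
    have "Z = sin (\<theta> / 2) * cos (\<theta> / 2) * (A + B)"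
      unfolding Z A_def B_def using pt by (simp add: field_simps)
    then have "Z * (2 * A * B / (A + B)) = 2 * (sin (\<theta> / 2) * A) * (cos (\<theta> / 2) * B)"
      using AB by (simp add: field_simps)
    also have "\<dots> = sin s" unfolding half_angle(1)[of s] A_def B_def using pt by simp
    finally show ?thesis by simp
  qed
  have DZ: "Z * d \<le> 2 * D"
  proof -
    have "d / 2 / 2 \<le> sin (d / 2)" by (rule sin_ge_half) (use range d in \<open>auto simp: d_def\<close>)
    also have "sin (d / 2) = \<bar>sin ((s - \<theta>) / 2)\<bar>"
    proof (cases "s \<ge> \<theta>")
      case True
      then have "sin ((s - \<theta>) / 2) \<ge> 0" using range by (intro sin_ge_zero) auto
      then show ?thesis using True by (simp add: d_def)
    next
      case False
      then have "sin ((\<theta> - s) / 2) \<ge> 0" using range by (intro sin_ge_zero) auto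
      moreover have "sin ((s - \<theta>) / 2) = - sin ((\<theta> - s) / 2)"
        by (metis minus_diff_eq minus_divide_left sin_minus)
      ultimately show ?thesis using False by (simp add: d_def)
    qed
    finally have "d / 4 \<le> \<bar>sin ((s - \<theta>) / 2)\<bar>" by simp
    then have "2 * Z * (d / 4) \<le> 2 * Z * \<bar>sin ((s - \<theta>) / 2)\<bar>" using Z0 by (intro mult_left_mono) auto
    also have "\<dots> = D" unfolding D_def cos_diff_cos Z_def[symmetric] using Z0 by (simp add: abs_mult)
    finally show ?thesis by simp
  qed
  have Q: "A powr a * B powr b * (2 * A * B / (A + B)) \<le> 2 * X powr \<gamma>"
  proof (rule ratio_bound[OF ab \<gamma> AB pt])
    show "(sin (\<theta> / 2))\<^sup>2 + (cos (\<theta> / 2))\<^sup>2 = 1" by simp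
    show "(A * sin (\<theta> / 2))\<^sup>2 + (B * cos (\<theta> / 2))\<^sup>2 = 1" using pt by (simp add: A_def B_def)
  qed (use AX BX X1' in auto)
  have "trig_weight a b s * sin s = trig_weight a b \<theta> * (Z * (A powr a * B powr b * (2 * A * B / (A + B))))"
    unfolding e1 e2 by (simp only: mult_ac)
  also have "\<dots> \<le> trig_weight a b \<theta> * (Z * (2 * X powr \<gamma>))"
    using wt Z0 Q by (intro mult_left_mono) auto
  also have "\<dots> \<le> trig_weight a b \<theta> * (2 * D / d * (2 * X powr \<gamma>))"
    using wt DZ d by (intro mult_left_mono mult_right_mono) (auto simp: field_simps)
  finally have 2: "trig_weight a b s * sin s \<le> trig_weight a b \<theta> * (2 * D / d * (2 * X powr \<gamma>))" .
  \<comment> \<open>The factor \<open>1/d\<close> from the difference of cosines turns this into \<open>2 / (1 + N d)\<close>.\<close>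
  have 3: "min (1 / N) d \<le> 2 * d / (1 + N * d)"
  proof (cases "N * d \<ge> 1")
    case True
    have "1 / N \<le> 2 * d / (1 + N * d)" using True N d by (simp add: field_simps)
    then show ?thesis by simp
  next
    case False
    have "d * (1 + N * d) \<le> d * 2" using False d by (intro mult_left_mono) auto
    moreover have "1 + N * d > 0" using N d by (simp add: add_pos_pos)
    ultimately have "d \<le> 2 * d / (1 + N * d)" by (simp add: pos_le_divide_eq mult.commute)
    then show ?thesis by simp
  qed
  have "trig_weight a b \<theta> * L * D \<le> e * (trig_weight a b \<theta> * (2 * D / d * (2 * X powr \<gamma>))) * (2 * d / (1 + N * d))"
    by (rule order_trans[OF 1], intro mult_mono mult_left_mono 2 3) (use e N d wt ws D in auto)
  also have "\<dots> = (trig_weight a b \<theta> * D) * (8 * e * X powr \<gamma> / (1 + N * d))"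
  proof -
    have "e * (w * (2 * D / d * (2 * y))) * (2 * d / q) = (w * D) * (8 * e * y / q)" for w y q :: real
      using d by (cases "q = 0") (simp_all add: field_simps)
    then show ?thesis .
  qed
  finally have "(trig_weight a b \<theta> * D) * L \<le> (trig_weight a b \<theta> * D) * (8 * e * X powr \<gamma> / (1 + N * d))" by (simp add: mult_ac)
  then have "L \<le> 8 * e * X powr \<gamma> / (1 + N * d)"
    using mult_pos_pos[OF wt D] by (simp only: mult_le_cancel_left_pos)
  also have "\<dots> = 8 * e * (2 / c) powr \<gamma> * (1 + N * d) powr (\<gamma> - 1)"
  proof -
    have pos: "1 + N * d > 0" using N d by (simp add: add_pos_pos)
    then have "X powr \<gamma> = (2 / c) powr \<gamma> * (1 + N * d) powr \<gamma>" unfolding X_def using c by (subst powr_mult) auto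
    then show ?thesis using pos by (simp add: powr_diff)
  qed
  also have "N * d = \<bar>N * s - N * \<theta>\<bar>"
    using N by (simp add: d_def abs_mult abs_minus_commute flip: right_diff_distrib)
  finally show ?thesis by (simp add: L_def)
qed

text \<open>Moving from \<open>y\<close> away from \<open>r\<close>, to \<open>x\<close>, increases the denominator of the basis polynomial at \<open>r\<close>.\<close>

lemma lagrange_basis_endpoint:
  assumes "poly P r = 0" "poly (pderiv P) r \<noteq> 0" and "\<bar>poly P x\<bar> \<le> 3 * \<bar>poly P y\<bar>"
    and "\<bar>y - r\<bar> \<le> \<bar>x - r\<bar>" "y \<noteq> r"
  shows "\<bar>poly (lagrange_basis P r) x\<bar> \<le> 3 * \<bar>poly (lagrange_basis P r) y\<bar>"
proof -
  let ?p = "\<bar>poly (pderiv P) r\<bar>"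
  have "\<bar>poly (lagrange_basis P r) x\<bar> * (?p * \<bar>y - r\<bar>) \<le> \<bar>poly (lagrange_basis P r) x\<bar> * (?p * \<bar>x - r\<bar>)"
    using assms by (intro mult_left_mono) auto
  also have "\<dots> = \<bar>poly P x\<bar>" using lagrange_basis_mult[OF assms(1,2), of x] by (metis abs_mult)
  also have "\<dots> \<le> 3 * \<bar>poly P y\<bar>" by fact
  also have "\<dots> = 3 * \<bar>poly (lagrange_basis P r) y\<bar> * (?p * \<bar>y - r\<bar>)"
    using lagrange_basis_mult[OF assms(1,2), of y] by (metis abs_mult mult.assoc)
  finally show ?thesis using assms by simp
qed

lemma one_minus_cos_bounds:
  fixes t :: real
  assumes "0 < t" "t \<le> 1/2"
  shows "0 < 1 - cos t" "1 - cos t \<le> 1" "1 - cos t \<le> t\<^sup>2 / 2"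
proof -
  have t: "t < pi / 2" using assms pi_gt3 by linarith
  have "1 - cos t = 2 * (sin (t / 2))\<^sup>2" using half_angle(2)[of t] by (simp add: cos_squared_eq)
  moreover have "0 < sin (t / 2)" using t assms by (intro sin_gt_zero) auto
  moreover have "sin (t / 2) \<le> t / 2" using assms by (intro sin_x_le_x) auto
  ultimately show "0 < 1 - cos t" "1 - cos t \<le> t\<^sup>2 / 2"
    using power_mono[of "sin (t / 2)" "t / 2" 2] by (auto simp: power_divide)
  have "cos t \<ge> 0" using t assms by (intro cos_ge_zero) auto
  then show "1 - cos t \<le> 1" by simp
qed

text \<open>The eigenvalue is at most \<open>N\<^sup>2\<close> and \<open>1 - cos (c/N) \<le> (c/N)\<^sup>2/2\<close>, so the cap of angular width \<open>c/N\<close> at 1 satisfies the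
  condition of \<open>jacobi_op_endpoint\<close> for a \<open>c\<close> that depends on the parameters only.\<close>

lemma jacobi_end_bounds:
  fixes \<alpha> \<beta> c :: real and n :: nat
  defines "N \<equiv> real n + (\<alpha> + \<beta> + 1) / 2"
  assumes ab: "\<alpha> > -1" "\<beta> > -1" and n: "n \<ge> 2"
    and c: "0 < c" "c \<le> 1/2" "c * (2 powr \<bar>\<beta>\<bar> / (\<alpha> + 1)) \<le> 1/2"
    and y: "jacobi_op \<alpha> \<beta> y = smult (- (real n * (real n + \<alpha> + \<beta> + 1))) y" "y \<noteq> 0"
    and x: "x \<in> {cos (c / N)..1}" "x' \<in> {cos (c / N)..1}"
  shows "\<bar>poly y x'\<bar> \<le> 3 * \<bar>poly y x\<bar>" "poly y x \<noteq> 0"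
proof -
  have n2: "real n \<ge> 2" using n by simp
  have N1: "N \<ge> 1" using ab n2 unfolding N_def by (simp add: field_simps)
  have t: "0 < c / N" "c / N \<le> 1/2" using N1 c by (auto simp: field_simps)
  note h = one_minus_cos_bounds[OF t]
  let ?lam = "real n * (real n + \<alpha> + \<beta> + 1)" and ?k = "2 powr \<bar>\<beta>\<bar> / (\<alpha> + 1)"
  have lam0: "?lam \<ge> 0" using ab n by simp
  have lamN: "?lam \<le> N\<^sup>2"
  proof -
    have "N\<^sup>2 = ?lam + ((\<alpha> + \<beta> + 1) / 2)\<^sup>2" by (simp add: N_def power2_eq_square field_simps)
    then show ?thesis by simp
  qed
  have k0: "?k \<ge> 0" using ab by simp
  have "?k * ?lam * (1 - cos (c / N)) \<le> ?k * N\<^sup>2 * ((c / N)\<^sup>2 / 2)"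
    using h lamN k0 lam0 by (intro mult_mono mult_left_mono mult_nonneg_nonneg) auto
  also have "\<dots> = c * ?k * c / 2" using N1 by (simp add: power2_eq_square field_simps)
  also have "\<dots> \<le> 1/2 * (1/2) / 2" using c k0 by (intro divide_right_mono mult_mono) auto
  finally have s: "?k * ?lam * (1 - cos (c / N)) \<le> 1/3" by simp
  show "\<bar>poly y x'\<bar> \<le> 3 * \<bar>poly y x\<bar>" "poly y x \<noteq> 0"
    using jacobi_op_endpoint[OF ab(1) y(1) lam0 y(2) h(1,2) s ab(2), of x x'] x by auto
qed

text \<open>On the angles in \<open>[c/N, \<pi> - c/N]\<close>, which contain those of all zeros, the pointwise bound is summed over the
  scaled angles \<open>T\<close> of the zeros. A point in one of the two caps is compared with the edge of its cap.\<close>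

theorem jacobi_lebesgue_function_bound:
  fixes \<alpha> \<beta> :: real
  assumes ab: "\<alpha> > -1" "\<beta> > -1"
  defines "\<gamma> \<equiv> max 0 (max \<alpha> \<beta> + 1/2)"
  shows "\<exists>C\<ge>0. \<forall>n\<ge>2. \<forall>x\<in>{-1..1}.
       (\<Sum>r\<in>jacobi_zeros \<alpha> \<beta> n. \<bar>poly (lagrange_basis (jacobi_poly \<alpha> \<beta> n) r) x\<bar>) \<le> C * rate \<gamma> n"
proof -
  define a where "a = \<alpha> + 1/2"
  define b where "b = \<beta> + 1/2"
  have ab': "a > -1" "b > -1" "\<gamma> \<ge> 0" "a \<le> \<gamma>" "b \<le> \<gamma>" using ab by (auto simp: a_def b_def \<gamma>_def)
  define k1 where "k1 = 2 powr \<bar>\<beta>\<bar> / (\<alpha> + 1)"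
  define k2 where "k2 = 2 powr \<bar>\<alpha>\<bar> / (\<beta> + 1)"
  have k12: "k1 \<ge> 0" "k2 \<ge> 0" using ab by (auto simp: k1_def k2_def)
  \<comment> \<open>The constants \<open>k1\<close> and \<open>k2\<close> are those of the end point estimates at 1 and at -1; one \<open>c\<close> serves both ends.\<close>
  define c where "c = 1 / (2 * (1 + k1 + k2))"
  have c: "0 < c" "c \<le> 1/2" "c * k1 \<le> 1/2" "c * k2 \<le> 1/2"
    using k12 by (auto simp: c_def field_simps)
  define k where "k = \<bar>a - a\<^sup>2\<bar> + \<bar>b - b\<^sup>2\<bar>"
  have k0: "k \<ge> 0" by (simp add: k_def)
  define \<kappa> where "\<kappa> = 2 * k / c"
  have \<kappa>0: "\<kappa> \<ge> 0" using k0 c by (simp add: \<kappa>_def)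
  define K where "K = 4 * k / c\<^sup>2"
  have K0: "K \<ge> 0" using k0 by (simp add: K_def)
  define \<delta> where "\<delta> = min (1/2) (1 / (exp \<kappa> * (1 + K)))"
  have \<delta>: "0 < \<delta>" "\<delta> \<le> 1/2" using K0 by (auto simp: \<delta>_def)
  define A where "A = pi * (1 + \<bar>\<alpha> + \<beta> + 1\<bar>)"
  have A: "A > 0" by (simp add: A_def add_pos_nonneg)
  obtain C1 where C1: "C1 \<ge> 0" "\<And>n T \<tau>. n \<ge> 2 \<Longrightarrow> finite T \<Longrightarrow> card T \<le> n \<Longrightarrow>
      (\<And>s s'. s \<in> T \<Longrightarrow> s' \<in> T \<Longrightarrow> s \<noteq> s' \<Longrightarrow> \<delta> \<le> \<bar>s - s'\<bar>) \<Longrightarrow>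
      (\<And>s. s \<in> T \<Longrightarrow> \<bar>s - \<tau>\<bar> \<le> A * real n) \<Longrightarrow>
      (\<Sum>s\<in>T. (1 + \<bar>s - \<tau>\<bar>) powr (\<gamma> - 1)) \<le> C1 * rate \<gamma> n"
    using separated_sum_rate[OF ab'(3) \<delta> A] by metis
  \<comment> \<open>The factor 3 pays for the caps.\<close>
  define C where "C = 3 * (8 * exp \<kappa> * (2 / c) powr \<gamma> * C1)"
  show ?thesis
  proof (intro exI[of _ C] conjI allI impI ballI)
    show "C \<ge> 0" using C1(1) by (simp add: C_def)
    fix n :: nat and x :: real assume n: "n \<ge> 2" and x: "x \<in> {-1..1}"
    define P where "P = jacobi_poly \<alpha> \<beta> n"
    define R where "R = jacobi_zeros \<alpha> \<beta> n"
    define N where "N = real n + (\<alpha> + \<beta> + 1) / 2"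
    have n2: "real n \<ge> 2" using n by simp
  have N1: "N \<ge> 1" using ab n2 unfolding N_def by (simp add: field_simps)
    then have N0: "N > 0" by simp
    note P = jacobi_poly_props[OF ab, of n, folded P_def]
    have P0: "P \<noteq> 0" using P(3) by auto
    have R: "R = {x. poly P x = 0}" by (simp add: R_def jacobi_zeros_def P_def)
    have finR: "finite R" unfolding R by (rule poly_roots_finite[OF P0])
    have cardR: "card R = n" unfolding R by (rule jacobi_orth_card_roots[OF ab P(1) P0 P(2)])
    have root: "poly P r = 0" "poly (pderiv P) r \<noteq> 0" "-1 < r" "r < 1" if "r \<in> R" for r
      using that jacobi_orth_roots_inside[OF ab P(1) P0 P(2)] jacobi_orth_roots_simple[OF ab P(1) P0 P(2)]
      by (auto simp: R)
    have cN: "0 < c / N" "c / N \<le> 1/2" using N1 c by (auto simp: field_simps)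
    have cN': "c / N < pi - c / N" using cN pi_gt3 by linarith
    have right: "\<bar>poly P x'\<bar> \<le> 3 * \<bar>poly P x\<bar>" "poly P x \<noteq> 0"
      if "x \<in> {cos (c / N)..1}" "x' \<in> {cos (c / N)..1}" for x x'
      using jacobi_end_bounds[OF ab n c(1,2) c(3)[unfolded k1_def] P(4) P0, of x x'] that
      by (auto simp: N_def)
    have left: "\<bar>poly P x'\<bar> \<le> 3 * \<bar>poly P x\<bar>" "poly P x \<noteq> 0"
      if h: "- x \<in> {cos (c / N)..1}" "- x' \<in> {cos (c / N)..1}" for x x'
    proof -
      have o: "jacobi_op \<beta> \<alpha> (P \<circ>\<^sub>p [:0, -1:]) = smult (- (real n * (real n + \<beta> + \<alpha> + 1))) (P \<circ>\<^sub>p [:0, -1:])"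
        using jacobi_op_reflect[OF P(4)] by (simp add: add_ac)
      have "poly (P \<circ>\<^sub>p [:0, -1:]) (-1) \<noteq> 0" using P(3) by (simp add: poly_pcompose)
      then have nz: "P \<circ>\<^sub>p [:0, -1:] \<noteq> 0" by auto
      have e: "real n + (\<beta> + \<alpha> + 1) / 2 = N" by (simp add: N_def)
      show "\<bar>poly P x'\<bar> \<le> 3 * \<bar>poly P x\<bar>" "poly P x \<noteq> 0"
        using jacobi_end_bounds[OF ab(2,1) n c(1,2) c(4)[unfolded k2_def] o nz, of "-x" "-x'"] h
        unfolding e by (auto simp: poly_pcompose)
    qed
    have arc: "arccos r \<in> {c / N..pi - c / N}" "cos (arccos r) = r" if "r \<in> R" for r
    proof -
      note rr = root[OF that]
      show cr: "cos (arccos r) = r" using rr by (intro cos_arccos) auto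
      have bd: "0 \<le> arccos r" "arccos r \<le> pi" using rr arccos_bounded[of r] by auto
      \<comment> \<open>A zero with an angle in a cap contradicts the absence of zeros there.\<close>
      have "\<not> arccos r < c / N"
      proof
        assume "arccos r < c / N"
        then have "cos (c / N) \<le> cos (arccos r)" using bd cN' cN by (intro cos_monotone_0_pi_le) auto
        then show False using right(2)[of r r] rr cr by auto
      qed
      moreover have "\<not> arccos r > pi - c / N"
      proof
        assume "arccos r > pi - c / N"
        then have "cos (c / N) \<le> cos (pi - arccos r)" using bd cN' cN by (intro cos_monotone_0_pi_le) auto
        then show False using left(2)[of r r] rr cr by auto
      qed
      ultimately show "arccos r \<in> {c / N..pi - c / N}" by auto
    qed
    define u where "u = (\<lambda>t. trig_weight a b t * poly P (cos t))"
    define v where "v = (\<lambda>t. trig_weight a b t * (trig_log_deriv a b t * poly P (cos t) - sin t * poly (pderiv P) (cos t)))"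
    have intpi: "0 < t" "t < pi" if "t \<in> {c / N..pi - c / N}" for t using that cN by auto
    have du: "(u has_real_derivative v t) (at t)" "(v has_real_derivative - (N\<^sup>2 + trig_potential a b t) * u t) (at t)"
      if "t \<in> {c / N..pi - c / N}" for t
      using trig_weight_ode[OF P(4) intpi[OF that]] unfolding u_def v_def a_def b_def N_def by auto
    have gb: "\<bar>trig_potential a b t\<bar> \<le> K * N\<^sup>2" if "t \<in> {c / N..pi - c / N}" for t
      using jacobi_energy(1)[OF P(4) _ c(1), of t] that N0 unfolding K_def k_def a_def b_def N_def by auto
    have en: "(v s)\<^sup>2 + N\<^sup>2 * (u s)\<^sup>2 \<le> exp (2 * \<kappa>) * ((v t)\<^sup>2 + N\<^sup>2 * (u t)\<^sup>2)"
      if "s \<in> {c / N..pi - c / N}" "t \<in> {c / N..pi - c / N}" for s t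
      using jacobi_energy(2)[OF P(4) _ c(1), of s t] that N0
      unfolding \<kappa>_def k_def a_def b_def N_def u_def v_def by auto
    have t0: "c / N \<in> {c / N..pi - c / N}" using cN' by auto
    have nz: "u (c / N) \<noteq> 0"
      using right(2)[of "cos (c / N)" "cos (c / N)"] trig_weight_pos[OF intpi[OF t0], of a b] by (simp add: u_def)
    have uz: "u (arccos r) = 0" if "r \<in> R" for r
      using root(1)[OF that] arc(2)[OF that] by (simp add: u_def)
    note cons = energy_consequences[OF N0 K0 du gb en t0 nz arc(1) uz]
    define T where "T = (\<lambda>r. N * arccos r) ` R"
    have inj: "inj_on (\<lambda>r. N * arccos r) R"
      using arc(2) N0 by (metis (no_types, lifting) inj_onI less_irrefl mult_cancel_left)
    have interior: "(\<Sum>r\<in>R. \<bar>poly (lagrange_basis P r) (cos \<theta>)\<bar>) \<le> C / 3 * rate \<gamma> n"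
      if \<theta>: "\<theta> \<in> {c / N..pi - c / N}" for \<theta>
    proof -
      have pw: "\<bar>poly (lagrange_basis P r) (cos \<theta>)\<bar> \<le> 8 * exp \<kappa> * (2 / c) powr \<gamma> * (1 + \<bar>N * arccos r - N * \<theta>\<bar>) powr (\<gamma> - 1)"
        if r: "r \<in> R" for r
      proof -
        have vs: "v (arccos r) = - (trig_weight a b (arccos r) * (sin (arccos r) * poly (pderiv P) (cos (arccos r))))"
          using root(1)[OF r] arc(2)[OF r] by (simp add: v_def)
        have "\<bar>u \<theta>\<bar> \<le> exp \<kappa> * \<bar>v (arccos r)\<bar> * min (1 / N) \<bar>\<theta> - arccos r\<bar>"
          by (rule cons(1)) (use r \<theta> in auto)
        then have "\<bar>trig_weight a b \<theta> * poly P (cos \<theta>)\<bar> \<le>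
          exp \<kappa> * \<bar>trig_weight a b (arccos r) * (sin (arccos r) * poly (pderiv P) (cos (arccos r)))\<bar> * min (1 / N) \<bar>\<theta> - arccos r\<bar>"
          unfolding vs abs_minus_cancel by (simp add: u_def)
        from lagrange_pointwise[OF ab' c(1) _ N0 _ \<theta> arc(1)[OF r] _ _ this] show ?thesis
          using c \<kappa>0 root[OF r] by (simp add: arc(2)[OF r])
      qed
      have "(\<Sum>r\<in>R. \<bar>poly (lagrange_basis P r) (cos \<theta>)\<bar>) \<le>
        (\<Sum>r\<in>R. 8 * exp \<kappa> * (2 / c) powr \<gamma> * (1 + \<bar>N * arccos r - N * \<theta>\<bar>) powr (\<gamma> - 1))"
        by (rule sum_mono[OF pw])
      also have "\<dots> = 8 * exp \<kappa> * (2 / c) powr \<gamma> * (\<Sum>s\<in>T. (1 + \<bar>s - N * \<theta>\<bar>) powr (\<gamma> - 1))"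
        unfolding T_def by (simp add: sum.reindex[OF inj] sum_distrib_left)
      also have "\<dots> \<le> 8 * exp \<kappa> * (2 / c) powr \<gamma> * (C1 * rate \<gamma> n)"
      proof (intro mult_left_mono C1(2)[OF n])
        show "finite T" by (simp add: T_def finR)
        show "card T \<le> n" unfolding T_def using card_image_le[OF finR] cardR by metis
        fix s assume "s \<in> T"
        then obtain r where r: "r \<in> R" "s = N * arccos r" by (auto simp: T_def)
        show "\<bar>s - N * \<theta>\<bar> \<le> A * real n"
        proof -
          have "\<bar>s - N * \<theta>\<bar> = N * \<bar>arccos r - \<theta>\<bar>" using N0 by (simp add: r abs_mult flip: right_diff_distrib)
          also have "\<dots> \<le> (real n * (1 + \<bar>\<alpha> + \<beta> + 1\<bar>)) * pi"
          proof (rule mult_mono)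
            have "\<bar>\<alpha> + \<beta> + 1\<bar> * 1 \<le> \<bar>\<alpha> + \<beta> + 1\<bar> * real n" using n by (intro mult_left_mono) auto
            moreover have "y / 2 \<le> \<bar>y\<bar>" for y :: real by (simp add: abs_if)
            note this[of "\<alpha> + \<beta> + 1"]
            ultimately show "N \<le> real n * (1 + \<bar>\<alpha> + \<beta> + 1\<bar>)" by (simp add: N_def algebra_simps)
            show "\<bar>arccos r - \<theta>\<bar> \<le> pi" using intpi[OF \<theta>] intpi[OF arc(1)[OF r(1)]] by (simp add: abs_le_iff)
          qed auto
          finally show ?thesis by (simp add: A_def mult_ac)
        qed
        fix s' assume "s' \<in> T" "s \<noteq> s'"
        then obtain r' where r': "r' \<in> R" "s' = N * arccos r'" by (auto simp: T_def)
        have "1 / (exp \<kappa> * (1 + K)) \<le> N * \<bar>arccos r' - arccos r\<bar>"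
          by (rule cons(2)) (use \<open>s \<noteq> s'\<close> r r' arc(1)[OF r'(1)] uz[OF r'(1)] in auto)
        also have "\<dots> = \<bar>s - s'\<bar>" using N0 by (simp add: r r' abs_mult abs_minus_commute flip: right_diff_distrib)
        finally show "\<delta> \<le> \<bar>s - s'\<bar>" by (simp add: \<delta>_def)
      qed auto
      finally show ?thesis by (simp add: C_def mult_ac)
    qed
    have rn: "C / 3 * rate \<gamma> n \<ge> 0" using \<open>C \<ge> 0\<close> rate_nonneg[of n \<gamma>] n by simp
    define \<theta> where "\<theta> = arccos x"
    have x\<theta>: "x = cos \<theta>" "0 \<le> \<theta>" "\<theta> \<le> pi" using x arccos_bounded[of x] by (auto simp: \<theta>_def)
    have "(\<Sum>r\<in>R. \<bar>poly (lagrange_basis P r) x\<bar>) \<le> C * rate \<gamma> n"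
    proof -
      consider "\<theta> \<in> {c / N..pi - c / N}" | "\<theta> < c / N" | "\<theta> > pi - c / N" by fastforce
      then show ?thesis
      proof cases
        case 1
        then show ?thesis using interior[OF 1] rn x\<theta>(1) by simp
      next
        case 2
        have xx: "x \<in> {cos (c / N)..1}"
          using 2 x\<theta> cN cN' x by (auto intro!: cos_monotone_0_pi_le)
        have "(\<Sum>r\<in>R. \<bar>poly (lagrange_basis P r) x\<bar>) \<le> (\<Sum>r\<in>R. 3 * \<bar>poly (lagrange_basis P r) (cos (c / N))\<bar>)"
        proof (rule sum_mono, rule lagrange_basis_endpoint)
          fix r assume r: "r \<in> R"
          have "cos (arccos r) \<le> cos (c / N)" using arc(1)[OF r] cN by (intro cos_monotone_0_pi_le) auto
          then have "r \<le> cos (c / N)" using arc(2)[OF r] by simp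
          moreover have "r \<noteq> cos (c / N)" using right(2)[of "cos (c / N)" "cos (c / N)"] root(1)[OF r] by auto
          ultimately show "\<bar>cos (c / N) - r\<bar> \<le> \<bar>x - r\<bar>" "cos (c / N) \<noteq> r" using xx by auto
          show "\<bar>poly P x\<bar> \<le> 3 * \<bar>poly P (cos (c / N))\<bar>" using right(1)[of "cos (c / N)" x] xx by auto
        qed (use root in auto)
        also have "\<dots> = 3 * (\<Sum>r\<in>R. \<bar>poly (lagrange_basis P r) (cos (c / N))\<bar>)" by (simp add: sum_distrib_left)
        finally show ?thesis using interior[OF t0] by simp
      next
        case 3
        have t1: "pi - c / N \<in> {c / N..pi - c / N}" using cN' by auto
        have xx: "- x \<in> {cos (c / N)..1}"
        proof -
          have "cos (c / N) \<le> cos (pi - \<theta>)" using 3 x\<theta> cN cN' by (intro cos_monotone_0_pi_le) auto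
          then show ?thesis using x x\<theta> by simp
        qed
        have "(\<Sum>r\<in>R. \<bar>poly (lagrange_basis P r) x\<bar>) \<le> (\<Sum>r\<in>R. 3 * \<bar>poly (lagrange_basis P r) (cos (pi - c / N))\<bar>)"
        proof (rule sum_mono, rule lagrange_basis_endpoint)
          fix r assume r: "r \<in> R"
          have "cos (pi - c / N) \<le> cos (arccos r)" using arc(1)[OF r] cN by (intro cos_monotone_0_pi_le) auto
          then have "r \<ge> cos (pi - c / N)" using arc(2)[OF r] by simp
          moreover have "r \<noteq> cos (pi - c / N)"
            using left(2)[of "- cos (c / N)" "- cos (c / N)"] root(1)[OF r] by auto
          ultimately show "\<bar>cos (pi - c / N) - r\<bar> \<le> \<bar>x - r\<bar>" "cos (pi - c / N) \<noteq> r" using xx by auto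
          show "\<bar>poly P x\<bar> \<le> 3 * \<bar>poly P (cos (pi - c / N))\<bar>" using left(1)[of "- cos (c / N)" x] xx by auto
        qed (use root in auto)
        also have "\<dots> = 3 * (\<Sum>r\<in>R. \<bar>poly (lagrange_basis P r) (cos (pi - c / N))\<bar>)" by (simp add: sum_distrib_left)
        finally show ?thesis using interior[OF t1] by simp
      qed
    qed
    then show "(\<Sum>r\<in>jacobi_zeros \<alpha> \<beta> n. \<bar>poly (lagrange_basis (jacobi_poly \<alpha> \<beta> n) r) x\<bar>) \<le> C * rate \<gamma> n"
      by (simp add: R_def P_def)
  qed
qed

section \<open>Symmetric polynomials in two variables\<close>

lemma finite_degree_simplex: "finite {(i, j). i + j \<le> (d::nat)}"
  by (rule finite_subset[of _ "{..d} \<times> {..d}"]) auto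

lemma polys2_zero: "(\<lambda>_. 0) \<in> polys2 d"
  unfolding polys2_def by (rule CollectI, rule exI[of _ "\<lambda>_ _. 0"]) auto

lemma polys2_add:
  assumes "p \<in> polys2 d" "q \<in> polys2 d"
  shows "(\<lambda>z. p z + q z) \<in> polys2 d"
proof -
  obtain c where c: "p = (\<lambda>(u, v). \<Sum>(i, j)\<in>{(i, j). i + j \<le> d}. c i j * u ^ i * v ^ j)"
    using assms(1) by (auto simp: polys2_def)
  obtain e where e: "q = (\<lambda>(u, v). \<Sum>(i, j)\<in>{(i, j). i + j \<le> d}. e i j * u ^ i * v ^ j)"
    using assms(2) by (auto simp: polys2_def)
  show ?thesis unfolding polys2_def
    by (rule CollectI, rule exI[of _ "\<lambda>i j. c i j + e i j"])
      (auto simp: c e fun_eq_iff case_prod_unfold distrib_right sum.distrib)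
qed

lemma polys2_scale:
  assumes "p \<in> polys2 d"
  shows "(\<lambda>z. k * p z) \<in> polys2 d"
proof -
  obtain c where c: "p = (\<lambda>(u, v). \<Sum>(i, j)\<in>{(i, j). i + j \<le> d}. c i j * u ^ i * v ^ j)"
    using assms(1) by (auto simp: polys2_def)
  show ?thesis unfolding polys2_def
    by (rule CollectI, rule exI[of _ "\<lambda>i j. k * c i j"])
      (auto simp: c fun_eq_iff case_prod_unfold sum_distrib_left mult.assoc)
qed

lemma polys2_diff:
  assumes "p \<in> polys2 d" "q \<in> polys2 d"
  shows "(\<lambda>z. p z - q z) \<in> polys2 d"
  using polys2_add[OF assms(1) polys2_scale[OF assms(2), of "-1"]] by simp

lemma polys2_sum:
  assumes "\<And>x. x \<in> A \<Longrightarrow> f x \<in> polys2 d"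
  shows "(\<lambda>z. \<Sum>x\<in>A. f x z) \<in> polys2 d"
  using assms by (induction A rule: infinite_finite_induct) (auto intro: polys2_add polys2_zero)

lemma polys2_monom:
  assumes "a + b \<le> d"
  shows "(\<lambda>(u, v). u ^ a * v ^ b) \<in> polys2 d"
proof -
  have "(\<Sum>(i, j)\<in>{(i, j). i + j \<le> d}. (if (i, j) = (a, b) then 1 else 0) * u ^ i * v ^ j) = u ^ a * v ^ b" for u v :: real
  proof -
    have "(\<Sum>(i, j)\<in>{(i, j). i + j \<le> d}. (if (i, j) = (a, b) then 1 else 0) * u ^ i * v ^ j) =
       (\<Sum>x\<in>{(i, j). i + j \<le> d}. if x = (a, b) then u ^ a * v ^ b else 0)"
      by (rule sum.cong) (auto split: if_splits)
    also have "\<dots> = u ^ a * v ^ b" using assms finite_degree_simplex[of d] by (simp add: sum.delta)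
    finally show ?thesis .
  qed
  then show ?thesis unfolding polys2_def
    by (intro CollectI exI[of _ "\<lambda>i j. if (i, j) = (a, b) then 1 else 0"]) auto
qed

lemma polys2_const: "(\<lambda>_. k) \<in> polys2 d"
  using polys2_scale[OF polys2_monom[of 0 0 d], of k] by (simp add: case_prod_unfold)

lemma polys2_shift:
  assumes "p \<in> polys2 d" "a + b + d \<le> e"
  shows "(\<lambda>(u, v). u ^ a * v ^ b * p (u, v)) \<in> polys2 e"
proof -
  obtain c where c: "p = (\<lambda>(u, v). \<Sum>(i, j)\<in>{(i, j). i + j \<le> d}. c i j * u ^ i * v ^ j)"
    using assms(1) by (auto simp: polys2_def)
  have "(\<lambda>(u, v). u ^ a * v ^ b * p (u, v)) =
     (\<lambda>z. \<Sum>x\<in>{(i, j). i + j \<le> d}. c (fst x) (snd x) * (\<lambda>(u, v). u ^ (a + fst x) * v ^ (b + snd x)) z)"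
    by (auto simp: c fun_eq_iff case_prod_unfold sum_distrib_left power_add mult_ac)
  also have "\<dots> \<in> polys2 e"
    by (intro polys2_sum polys2_scale polys2_monom) (use assms(2) in auto)
  finally show ?thesis .
qed

text \<open>Newton's recurrence \<open>x\<^sup>d + y\<^sup>d = u (x\<^sup>d\<^sup>-\<^sup>1 + y\<^sup>d\<^sup>-\<^sup>1) - v (x\<^sup>d\<^sup>-\<^sup>2 + y\<^sup>d\<^sup>-\<^sup>2)\<close> with \<open>u = x + y\<close>, \<open>v = x y\<close>.\<close>

lemma power_sum_symmetric:
  "\<exists>p\<in>polys2 d. \<forall>x y. p (x + y, x * y) = x ^ d + y ^ d"
proof (induction d rule: less_induct)
  case (less d)
  consider "d = 0" | "d = 1" | e where "d = Suc (Suc e)" by (metis One_nat_def not0_implies_Suc)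
  then show ?case
  proof cases
    case 1
    then show ?thesis by (intro bexI[of _ "\<lambda>_. 2"]) (auto intro: polys2_const)
  next
    case 2
    then show ?thesis using polys2_monom[of 1 0 1]
      by (intro bexI[of _ "\<lambda>(u, v). u ^ 1 * v ^ 0"]) auto
  next
    case (3 e)
    obtain p where p: "p \<in> polys2 (Suc e)" "\<And>x y. p (x + y, x * y) = x ^ Suc e + y ^ Suc e"
      using less[of "Suc e"] 3 by auto
    obtain q where q: "q \<in> polys2 e" "\<And>x y. q (x + y, x * y) = x ^ e + y ^ e"
      using less[of e] 3 by auto
    have "(\<lambda>z. (\<lambda>(u, v). u ^ 1 * v ^ 0 * p (u, v)) z - (\<lambda>(u, v). u ^ 0 * v ^ 1 * q (u, v)) z) \<in> polys2 d"
      by (intro polys2_diff polys2_shift[OF p(1)] polys2_shift[OF q(1)]) (use 3 in auto)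
    then show ?thesis
    proof (rule bexI[rotated], intro allI)
      fix x y :: real
      show "(\<lambda>(u, v). u ^ 1 * v ^ 0 * p (u, v)) (x + y, x * y) - (\<lambda>(u, v). u ^ 0 * v ^ 1 * q (u, v)) (x + y, x * y) = x ^ d + y ^ d"
        using 3 by (simp add: p q algebra_simps)
    qed
  qed
qed

text \<open>For \<open>i \<le> j\<close> the sum is \<open>v\<^sup>i (x\<^sup>j\<^sup>-\<^sup>i + y\<^sup>j\<^sup>-\<^sup>i)\<close>, of total degree at most \<open>i + (j - i) = j\<close> in \<open>(u, v)\<close>.\<close>

lemma symmetric_monom:
  assumes "i \<le> d" "j \<le> d"
  shows "\<exists>p\<in>polys2 d. \<forall>x y. p (x + y, x * y) = x ^ i * y ^ j + x ^ j * y ^ i"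
proof -
  have main: "\<exists>p\<in>polys2 d. \<forall>x y. p (x + y, x * y) = x ^ i * y ^ j + x ^ j * y ^ i" if "i \<le> j" "j \<le> d" for i j
  proof -
    obtain p where p: "p \<in> polys2 (j - i)" "\<And>x y. p (x + y, x * y) = x ^ (j - i) + y ^ (j - i)"
      using power_sum_symmetric by blast
    have "(\<lambda>(u, v). u ^ 0 * v ^ i * p (u, v)) \<in> polys2 d"
      by (rule polys2_shift[OF p(1)]) (use that in auto)
    moreover have "(x * y) ^ i * (x ^ (j - i) + y ^ (j - i)) = x ^ i * y ^ j + x ^ j * y ^ i" for x y :: real
    proof -
      have "x ^ j = x ^ i * x ^ (j - i)" "y ^ j = y ^ i * y ^ (j - i)"
        using that by (simp_all flip: power_add)
      then show ?thesis by (simp add: algebra_simps power_mult_distrib)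
    qed
    ultimately show ?thesis by (intro bexI[of _ "\<lambda>(u, v). u ^ 0 * v ^ i * p (u, v)"]) (auto simp: p)
  qed
  show ?thesis
  proof (cases "i \<le> j")
    case True then show ?thesis using main assms by blast
  next
    case False
    then show ?thesis using main[of j i] assms by (simp add: add.commute)
  qed
qed

lemma symmetric_product:
  fixes f g :: "real poly"
  assumes "degree f \<le> d" "degree g \<le> d"
  shows "\<exists>p\<in>polys2 d. \<forall>x y. p (x + y, x * y) = poly f x * poly g y + poly f y * poly g x"
proof -
  define m where "m = (\<lambda>i j. SOME p. p \<in> polys2 d \<and> (\<forall>x y. p (x + y, x * y) = x ^ i * y ^ j + x ^ j * y ^ i))"
  have "m i j \<in> polys2 d \<and> (\<forall>x y. m i j (x + y, x * y) = x ^ i * y ^ j + x ^ j * y ^ i)"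
    if "i \<le> d" "j \<le> d" for i j
    unfolding m_def using someI_ex[OF symmetric_monom[OF that, unfolded Bex_def]] by simp
  then have m: "\<And>i j. i \<le> d \<Longrightarrow> j \<le> d \<Longrightarrow> m i j \<in> polys2 d"
    "\<And>i j x y. i \<le> d \<Longrightarrow> j \<le> d \<Longrightarrow> m i j (x + y, x * y) = x ^ i * y ^ j + x ^ j * y ^ i"
    by blast+
  have pf: "poly f x = (\<Sum>i\<le>d. coeff f i * x ^ i)" and pg: "poly g x = (\<Sum>i\<le>d. coeff g i * x ^ i)" for x
    unfolding poly_altdef by (rule sum.mono_neutral_left; use assms in \<open>auto simp: coeff_eq_0\<close>)+
  let ?p = "\<lambda>z. \<Sum>i\<le>d. \<Sum>j\<le>d. (coeff f i * coeff g j) * m i j z"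
  show ?thesis
  proof (rule bexI[of _ ?p], intro allI)
    show "?p \<in> polys2 d" by (intro polys2_sum polys2_scale m) auto
    fix x y :: real
    have "?p (x + y, x * y) = (\<Sum>i\<le>d. \<Sum>j\<le>d. (coeff f i * x ^ i) * (coeff g j * y ^ j) + (coeff f i * y ^ i) * (coeff g j * x ^ j))"
      by (intro sum.cong) (auto simp: m algebra_simps)
    also have "\<dots> = poly f x * poly g y + poly f y * poly g x"
      unfolding pf pg by (simp add: sum.distrib sum_product)
    finally show "?p (x + y, x * y) = poly f x * poly g y + poly f y * poly g x" .
  qed
qed

lemma polys2_separate:
  assumes "p \<in> polys2 d"
  obtains h where "degree h \<le> d" "\<And>x. poly h x = p (x + y, x * y)"
proof -
  obtain c where c: "p = (\<lambda>(u, v). \<Sum>(i, j)\<in>{(i, j). i + j \<le> d}. c i j * u ^ i * v ^ j)"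
    using assms(1) by (auto simp: polys2_def)
  let ?h = "\<Sum>(i, j)\<in>{(i, j). i + j \<le> d}. smult (c i j) ([:y, 1:] ^ i * [:0, y:] ^ j)"
  show thesis
  proof (rule that)
    show "degree ?h \<le> d"
    proof (rule degree_sum_le[OF finite_degree_simplex])
      fix q :: "nat \<times> nat" assume "q \<in> {(i, j). i + j \<le> d}"
      then obtain i j where ij: "q = (i, j)" "i + j \<le> d" by auto
      have "degree (smult (c i j) ([:y, 1:] ^ i * [:0, y:] ^ j)) \<le> degree ([:y, 1:] ^ i * [:0, y:] ^ j)"
        by (rule degree_smult_le)
      also have "\<dots> \<le> degree ([:y, 1:] ^ i) + degree ([:0, y:] ^ j)" by (rule degree_mult_le)
      also have "\<dots> \<le> degree [:y, 1:] * i + degree [:0, y:] * j"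
        by (intro add_mono degree_power_le)
      also have "\<dots> \<le> 1 * i + 1 * j" by (intro add_mono mult_right_mono) auto
      finally show "degree (case q of (i, j) \<Rightarrow> smult (c i j) ([:y, 1:] ^ i * [:0, y:] ^ j)) \<le> d" using ij by simp
    qed
    show "poly ?h x = p (x + y, x * y)" for x
      by (simp add: c poly_sum case_prod_unfold mult_ac add_ac)
  qed
qed

text \<open>For fixed \<open>y\<close> the function \<open>x \<mapsto> p (x + y, x y)\<close> is a polynomial of degree at most \<open>d\<close>; zeros on the grid
  \<open>R \<times> R\<close> therefore spread first to \<open>\<real> \<times> R\<close> and then to the plane. The points \<open>(x + y, x y)\<close> only fill
  the region \<open>u\<^sup>2 \<ge> 4 v\<close>, but for fixed \<open>u\<close> this contains infinitely many \<open>v\<close>.\<close>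

lemma polys2_unisolvent:
  assumes p: "p \<in> polys2 d" and R: "finite R" "card R > d"
    and z: "\<And>x y. x \<in> R \<Longrightarrow> y \<in> R \<Longrightarrow> p (x + y, x * y) = 0"
  shows "p = (\<lambda>_. 0)"
proof -
  have step: "p (x + y, x * y) = 0" if "\<And>x. x \<in> R \<Longrightarrow> p (x + y, x * y) = 0" for x y
  proof -
    obtain h where h: "degree h \<le> d" "\<And>x. poly h x = p (x + y, x * y)"
      using polys2_separate[OF p] by metis
    have "h = 0"
    proof (rule ccontr)
      assume "h \<noteq> 0"
      have "card R \<le> card {x. poly h x = 0}"
        by (rule card_mono[OF poly_roots_finite[OF \<open>h \<noteq> 0\<close>]]) (use that h in auto)
      also have "\<dots> \<le> degree h" using card_poly_roots_bound[OF \<open>h \<noteq> 0\<close>] .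
      finally show False using h R by simp
    qed
    then show ?thesis using h(2)[of x] by simp
  qed
  have 1: "p (x + y, x * y) = 0" if "y \<in> R" for x y using step z that by blast
  have 2: "p (x + y, x * y) = 0" for x y
  proof (rule step)
    fix x assume "x \<in> R"
    then show "p (x + y, x * y) = 0" using 1[of x y] by (simp add: add.commute mult.commute)
  qed
  have real_disc: "p (u, v) = 0" if "u\<^sup>2 \<ge> 4 * v" for u v
  proof -
    define s where "s = sqrt (u\<^sup>2 - 4 * v)"
    have "s\<^sup>2 = u\<^sup>2 - 4 * v" using that by (simp add: s_def)
    then have "(u - s) / 2 * ((u + s) / 2) = v" by (simp add: power2_eq_square field_simps)
    moreover have "(u - s) / 2 + (u + s) / 2 = u" by (simp add: field_simps)
    ultimately show ?thesis using 2[of "(u - s) / 2" "(u + s) / 2"] by simp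
  qed
  show ?thesis
  proof
    fix z :: "real \<times> real"
    obtain u w where zz: "z = (u, w)" by fastforce
    obtain c where c: "p = (\<lambda>(u, v). \<Sum>(i, j)\<in>{(i, j). i + j \<le> d}. c i j * u ^ i * v ^ j)"
      using p by (auto simp: polys2_def)
    define h where "h = (\<Sum>(i, j)\<in>{(i, j). i + j \<le> d}. smult (c i j * u ^ i) ([:0, 1:] ^ j))"
    have h: "poly h v = p (u, v)" for v by (simp add: h_def c poly_sum case_prod_unfold)
    have "{..u\<^sup>2 / 4} \<subseteq> {v. poly h v = 0}" using real_disc h by auto
    moreover have "infinite {..u\<^sup>2 / 4}" by (simp add: infinite_Iic)
    ultimately have "h = 0" using poly_roots_finite[of h] finite_subset by blast
    then show "p z = 0" using h[of w] by (simp add: zz)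
  qed
qed

section \<open>Reduction of the cubature interpolation to one variable\<close>

lemma closure_Omega_subset:
  "closure Omega \<subseteq> {(x + y, x * y) | x y. -1 \<le> x \<and> x \<le> y \<and> y \<le> 1}" (is "_ \<subseteq> ?T")
  and compact_closure_Omega: "compact (closure Omega)"
proof -
  let ?f = "\<lambda>z::real \<times> real. (fst z + snd z, fst z * snd z)"
  let ?S = "cbox (-1, -1) (1, 1) \<inter> {z::real \<times> real. fst z \<le> snd z}"
  have "compact ?S"
    by (intro compact_Int_closed compact_cbox closed_Collect_le continuous_intros)
  then have comp: "compact (?f ` ?S)"
    by (intro compact_continuous_image continuous_intros)
  have T: "?T = ?f ` ?S"
  proof (intro equalityI subsetI)
    fix z assume "z \<in> ?T"
    then obtain x y where "z = (x + y, x * y)" "-1 \<le> x" "x \<le> y" "y \<le> 1" by blast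
    then show "z \<in> ?f ` ?S" by (intro image_eqI[of _ _ "(x, y)"]) auto
  next
    fix z assume "z \<in> ?f ` ?S"
    then obtain x y where "z = (x + y, x * y)" "-1 \<le> x" "x \<le> y" "y \<le> 1" by auto
    then show "z \<in> ?T" by blast
  qed
  have sub: "Omega \<subseteq> ?T" unfolding Omega_eq_image by (auto intro: less_imp_le)
  then show c: "closure Omega \<subseteq> ?T"
    using comp compact_imp_closed unfolding T by (intro closure_minimal) auto
  show "compact (closure Omega)"
    using bounded_subset[OF compact_imp_bounded[OF comp]] sub unfolding T compact_closure by blast
qed

text \<open>Nodes on the diagonal lie on the bounding parabola of \<open>Omega\<close>; they are limits of points with \<open>y\<close> slightly larger.\<close>

lemma in_closure_Omega:
  assumes "-1 < x" "x \<le> y" "y < 1"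
  shows "(x + y, x * y) \<in> closure Omega"
proof (cases "x = y")
  case False
  then have "(x + y, x * y) \<in> Omega" unfolding Omega_eq_image using assms by force
  then show ?thesis using closure_subset by blast
next
  case True
  define e where "e = (\<lambda>n. (1 - x) * inverse (real (Suc (Suc n))))"
  have e: "0 < e n" "e n < 1 - x" for n
  proof -
    have "inverse (real (Suc (Suc n))) < 1" "inverse (real (Suc (Suc n))) > 0" by (auto simp: field_simps)
    then show "0 < e n" "e n < 1 - x" using assms unfolding e_def by (auto simp: mult_less_cancel_left2)
  qed
  have "(\<lambda>n. inverse (real (Suc (Suc n)))) \<longlonglongrightarrow> 0"
    using LIMSEQ_inverse_real_of_nat LIMSEQ_Suc by blast
  then have "e \<longlonglongrightarrow> (1 - x) * 0" unfolding e_def by (intro tendsto_mult tendsto_const)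
  then have e0: "e \<longlonglongrightarrow> 0" by simp
  have "(\<lambda>n. (x + (x + e n), x * (x + e n))) \<longlonglongrightarrow> (x + (x + 0), x * (x + 0))"
    by (intro tendsto_intros e0)
  moreover have "(x + (x + e n), x * (x + e n)) \<in> Omega" for n
    unfolding Omega_eq_image using e[of n] assms
    by (intro CollectI exI[of _ x] exI[of _ "x + e n"]) auto
  ultimately have "\<exists>g. (\<forall>n. g n \<in> Omega) \<and> g \<longlonglongrightarrow> (x + (x + 0), x * (x + 0))"
    by (intro exI[of _ "\<lambda>n. (x + (x + e n), x * (x + e n))"]) blast
  then show ?thesis unfolding closure_sequential using True by simp
qed

text \<open>The tensor product interpolant is symmetric in \<open>x\<close> and \<open>y\<close> because its data \<open>f (r + s, r s)\<close> are. Pairing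
  the terms \<open>(r, s)\<close> and \<open>(s, r)\<close> writes it as a polynomial \<open>p\<close> of degree at most \<open>n - 1\<close> in \<open>(u, v)\<close>.\<close>

lemma interp_eq_tensor:
  fixes \<alpha> \<beta> :: real and n :: nat
  assumes ab: "\<alpha> > -1" "\<beta> > -1" and n: "n \<ge> 1"
  defines "R \<equiv> jacobi_zeros \<alpha> \<beta> n" and "l \<equiv> \<lambda>r. poly (lagrange_basis (jacobi_poly \<alpha> \<beta> n) r)"
  shows "interp \<alpha> \<beta> n f (x + y, x * y) = (\<Sum>r\<in>R. \<Sum>s\<in>R. f (r + s, r * s) * (l r x * l s y))"
proof -
  define P where "P = jacobi_poly \<alpha> \<beta> n"
  note P = jacobi_poly_props[OF ab, of n, folded P_def]
  have P0: "P \<noteq> 0" using P(3) by auto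
  have R: "R = {x. poly P x = 0}" by (simp add: R_def jacobi_zeros_def P_def)
  have finR: "finite R" unfolding R by (rule poly_roots_finite[OF P0])
  have cardR: "card R = n" unfolding R by (rule jacobi_orth_card_roots[OF ab P(1) P0 P(2)])
  have root: "poly P r = 0" "poly (pderiv P) r \<noteq> 0" if "r \<in> R" for r
    using that jacobi_orth_roots_simple[OF ab P(1) P0 P(2)] by (auto simp: R)
  have l: "l r = poly (lagrange_basis P r)" for r by (simp add: l_def P_def)
  have l_delta: "l r s = (if r = s then 1 else 0)" if "r \<in> R" "s \<in> R" for r s
    using lagrange_basis_self[OF root[OF that(1)]] lagrange_basis_other[OF root[OF that(1)] root(1)[OF that(2)]] by (auto simp: l)
  define q where "q = (\<lambda>r s. SOME p. p \<in> polys2 (n - 1) \<and>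
    (\<forall>x y. p (x + y, x * y) = l r x * l s y + l r y * l s x))"
  have "q r s \<in> polys2 (n - 1) \<and> (\<forall>x y. q r s (x + y, x * y) = l r x * l s y + l r y * l s x)"
    if "r \<in> R" "s \<in> R" for r s
  proof -
    have ex: "\<exists>p\<in>polys2 (n - 1). \<forall>x y. p (x + y, x * y) = l r x * l s y + l r y * l s x"
      unfolding l using degree_lagrange_basis[OF P0 root(1)] P(1) that by (intro symmetric_product) auto
    show ?thesis unfolding q_def using someI_ex[OF ex[unfolded Bex_def]] by simp
  qed
  then have q: "\<And>r s. r \<in> R \<Longrightarrow> s \<in> R \<Longrightarrow> q r s \<in> polys2 (n - 1)"
    "\<And>r s x y. r \<in> R \<Longrightarrow> s \<in> R \<Longrightarrow> q r s (x + y, x * y) = l r x * l s y + l r y * l s x"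
    by blast+
  define p where "p = (\<lambda>z. \<Sum>r\<in>R. \<Sum>s\<in>R. (f (r + s, r * s) / 2) * q r s z)"
  have pin: "p \<in> polys2 (n - 1)"
    unfolding p_def by (intro polys2_sum polys2_scale q)
  have pval: "p (x + y, x * y) = (\<Sum>r\<in>R. \<Sum>s\<in>R. f (r + s, r * s) * (l r x * l s y))" for x y
  proof -
    let ?g = "\<lambda>r s. f (r + s, r * s) / 2 * (l r x * l s y)"
    have "p (x + y, x * y) = (\<Sum>r\<in>R. \<Sum>s\<in>R. ?g r s + ?g s r)"
      unfolding p_def by (intro sum.cong) (auto simp: q algebra_simps)
    also have "\<dots> = (\<Sum>r\<in>R. \<Sum>s\<in>R. ?g r s) + (\<Sum>r\<in>R. \<Sum>s\<in>R. ?g s r)" by (simp add: sum.distrib)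
    also have "(\<Sum>r\<in>R. \<Sum>s\<in>R. ?g s r) = (\<Sum>r\<in>R. \<Sum>s\<in>R. ?g r s)" by (rule sum.swap)
    also have "(\<Sum>r\<in>R. \<Sum>s\<in>R. ?g r s) + (\<Sum>r\<in>R. \<Sum>s\<in>R. ?g r s) = (\<Sum>r\<in>R. \<Sum>s\<in>R. ?g r s + ?g r s)"
      by (simp only: sum.distrib)
    also have "\<dots> = (\<Sum>r\<in>R. \<Sum>s\<in>R. f (r + s, r * s) * (l r x * l s y))"
      by (intro sum.cong refl) simp
    finally show ?thesis .
  qed
  have pnode: "p (x + y, x * y) = f (x + y, x * y)" if "x \<in> R" "y \<in> R" for x y
  proof -
    have "p (x + y, x * y) = (\<Sum>r\<in>R. \<Sum>s\<in>R. if s = y then (if r = x then f (r + s, r * s) else 0) else 0)"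
      unfolding pval by (intro sum.cong) (auto simp: l_delta that)
    also have "\<dots> = f (x + y, x * y)" using that finR by (simp add: sum.delta)
    finally show ?thesis .
  qed
  have "interp \<alpha> \<beta> n f = p"
    unfolding interp_def
  proof (rule the_equality)
    show "p \<in> polys2 (n - 1) \<and> (\<forall>z\<in>cubature_nodes \<alpha> \<beta> n. p z = f z)"
      using pin pnode by (auto simp: cubature_nodes_def R_def)
    fix p' assume p': "p' \<in> polys2 (n - 1) \<and> (\<forall>z\<in>cubature_nodes \<alpha> \<beta> n. p' z = f z)"
    have "(\<lambda>z. p' z - p z) = (\<lambda>_. 0)"
    proof (rule polys2_unisolvent[OF polys2_diff finR])
      show "p' \<in> polys2 (n - 1)" "p \<in> polys2 (n - 1)" using p' pin by auto
      show "n - 1 < card R" using cardR n by simp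
      have eq: "p' (x + y, x * y) - p (x + y, x * y) = 0" if "x \<in> R" "y \<in> R" "x \<le> y" for x y
        using p' pnode[of x y] that by (auto simp: cubature_nodes_def R_def)
      show "p' (x + y, x * y) - p (x + y, x * y) = 0" if "x \<in> R" "y \<in> R" for x y
        using eq[of x y] eq[of y x] that by (cases "x \<le> y") (auto simp: add.commute mult.commute)
    qed
    then show "p' = p" by (simp add: fun_eq_iff)
  qed
  then show ?thesis by (simp add: pval)
qed

lemma unif_norm_ge:
  assumes "continuous_on (closure Omega) f" "z \<in> closure Omega"
  shows "\<bar>f z\<bar> \<le> unif_norm f"
proof -
  have "compact ((\<lambda>z. \<bar>f z\<bar>) ` closure Omega)"
    using assms(1) compact_closure_Omega by (intro compact_continuous_image continuous_intros)
  then have "bdd_above ((\<lambda>z. \<bar>f z\<bar>) ` closure Omega)"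
    by (intro bounded_imp_bdd_above compact_imp_bounded)
  then show ?thesis unfolding unif_norm_def using assms(2) by (intro cSUP_upper)
qed

text \<open>On \<open>closure Omega\<close> both \<open>x\<close> and \<open>y\<close> lie in \<open>[-1, 1]\<close>, and the double sum of absolute values factorizes.
  The bound also shows that the suprema in the definition are taken over bounded sets.\<close>

lemma lebesgue_constant_bound:
  fixes \<alpha> \<beta> B :: real and n :: nat
  assumes ab: "\<alpha> > -1" "\<beta> > -1" and n: "n \<ge> 1"
    and B: "\<And>x. x \<in> {-1..1} \<Longrightarrow> (\<Sum>r\<in>jacobi_zeros \<alpha> \<beta> n. \<bar>poly (lagrange_basis (jacobi_poly \<alpha> \<beta> n) r) x\<bar>) \<le> B"
  shows "0 \<le> lebesgue_constant \<alpha> \<beta> n \<and> lebesgue_constant \<alpha> \<beta> n \<le> B\<^sup>2"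
proof -
  define R where "R = jacobi_zeros \<alpha> \<beta> n"
  define l where "l = (\<lambda>r. poly (lagrange_basis (jacobi_poly \<alpha> \<beta> n) r))"
  have B: "(\<Sum>r\<in>R. \<bar>l r x\<bar>) \<le> B" if "x \<in> {-1..1}" for x
    unfolding R_def l_def by (rule B[OF that])
  have "0 \<le> (\<Sum>r\<in>R. \<bar>l r 0\<bar>)" by (rule sum_nonneg) simp
  also have "\<dots> \<le> B" by (rule B) simp
  finally have B0: "B \<ge> 0" .
  have z0: "(0 + 0, 0 * 0) \<in> closure Omega" by (rule in_closure_Omega) auto
  have ne: "closure Omega \<noteq> {}"
  proof
    assume "closure Omega = {}"
    with z0 show False by simp
  qed
  have Rin: "(r + s, r * s) \<in> closure Omega" if "r \<in> R" "s \<in> R" for r s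
  proof -
    note P = jacobi_poly_props[OF ab, of n]
    have P0: "jacobi_poly \<alpha> \<beta> n \<noteq> 0" using P(3) by auto
    have "-1 < r \<and> r < 1" "-1 < s \<and> s < 1"
      using that jacobi_orth_roots_inside[OF ab P(1) P0 P(2)] by (auto simp: R_def jacobi_zeros_def)
    then show ?thesis using in_closure_Omega[of r s] in_closure_Omega[of s r]
      by (cases "r \<le> s") (auto simp: add.commute mult.commute)
  qed
  have bound: "\<bar>interp \<alpha> \<beta> n f z\<bar> \<le> unif_norm f * B\<^sup>2"
    if f: "continuous_on (closure Omega) f" and z: "z \<in> closure Omega" for f z
  proof -
    have M0: "unif_norm f \<ge> 0" using unif_norm_ge[OF f z0] by (rule order_trans[rotated]) simp
    obtain x y where xy: "z = (x + y, x * y)" "x \<in> {-1..1}" "y \<in> {-1..1}"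
    proof -
      obtain x y where "z = (x + y, x * y)" "-1 \<le> x" "x \<le> y" "y \<le> 1"
        using closure_Omega_subset z by blast
      then show ?thesis using that[of x y] by auto
    qed
    have "\<bar>interp \<alpha> \<beta> n f z\<bar> = \<bar>\<Sum>r\<in>R. \<Sum>s\<in>R. f (r + s, r * s) * (l r x * l s y)\<bar>"
      unfolding xy(1) interp_eq_tensor[OF ab n] R_def l_def ..
    also have "\<dots> \<le> (\<Sum>r\<in>R. \<Sum>s\<in>R. \<bar>f (r + s, r * s) * (l r x * l s y)\<bar>)"
      by (rule order_trans[OF sum_abs], rule sum_mono, rule sum_abs)
    also have "\<dots> \<le> (\<Sum>r\<in>R. \<Sum>s\<in>R. unif_norm f * (\<bar>l r x\<bar> * \<bar>l s y\<bar>))"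
      unfolding abs_mult using Rin unif_norm_ge[OF f] by (intro sum_mono mult_right_mono) auto
    also have "\<dots> = unif_norm f * ((\<Sum>r\<in>R. \<bar>l r x\<bar>) * (\<Sum>s\<in>R. \<bar>l s y\<bar>))"
      unfolding sum_product by (simp only: sum_distrib_left)
    also have "\<dots> \<le> unif_norm f * (B * B)"
      using B xy M0 B0 by (intro mult_left_mono mult_mono) (auto intro: sum_nonneg)
    finally show ?thesis by (simp add: power2_eq_square)
  qed
  have ratio: "0 \<le> unif_norm (interp \<alpha> \<beta> n f) / unif_norm f \<and> unif_norm (interp \<alpha> \<beta> n f) / unif_norm f \<le> B\<^sup>2"
    if f: "continuous_on (closure Omega) f" for f
  proof -
    have M0: "unif_norm f \<ge> 0" using unif_norm_ge[OF f z0] by (rule order_trans[rotated]) simp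
    have up: "unif_norm (interp \<alpha> \<beta> n f) \<le> unif_norm f * B\<^sup>2"
      unfolding unif_norm_def[of "interp \<alpha> \<beta> n f"] by (rule cSUP_least[OF ne bound[OF f]])
    have bdd: "bdd_above ((\<lambda>z. \<bar>interp \<alpha> \<beta> n f z\<bar>) ` closure Omega)"
      using bound[OF f] by (intro bdd_aboveI2)
    have "\<bar>interp \<alpha> \<beta> n f (0 + 0, 0 * 0)\<bar> \<le> unif_norm (interp \<alpha> \<beta> n f)"
      unfolding unif_norm_def by (rule cSUP_upper[OF z0 bdd])
    then have lo: "unif_norm (interp \<alpha> \<beta> n f) \<ge> 0" by (rule order_trans[rotated]) simp
    show ?thesis
    proof (cases "unif_norm f = 0")
      case True then show ?thesis by simp
    next
      case False
      then show ?thesis using up lo M0 by (simp add: field_simps)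
    qed
  qed
  let ?F = "{f. continuous_on (closure Omega) f}"
  let ?q = "\<lambda>f. unif_norm (interp \<alpha> \<beta> n f) / unif_norm f"
  have c0: "(\<lambda>_. 0) \<in> ?F" by simp
  have "lebesgue_constant \<alpha> \<beta> n \<le> B\<^sup>2"
    unfolding lebesgue_constant_def by (rule cSUP_least) (use c0 ratio in auto)
  moreover have "bdd_above (?q ` ?F)" using ratio by (intro bdd_aboveI2) auto
  then have "?q (\<lambda>_. 0) \<le> lebesgue_constant \<alpha> \<beta> n"
    unfolding lebesgue_constant_def by (intro cSUP_upper c0)
  moreover have "0 \<le> ?q (\<lambda>_. 0)" using ratio c0 by blast
  ultimately show ?thesis by linarith
qed

theorem corollary5p3:
  fixes \<alpha> \<beta> :: real
  assumes "\<alpha> > -1" and "\<beta> > -1"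
  shows "(\<lambda>n. lebesgue_constant \<alpha> \<beta> n) \<in>
    O(\<lambda>n. if max \<alpha> \<beta> > -1/2 then real n powr (2 * max \<alpha> \<beta> + 1) else (ln (real n))\<^sup>2)"
proof -
  let ?\<gamma> = "max 0 (max \<alpha> \<beta> + 1/2)"
  obtain C where C: "C \<ge> 0" "\<And>n x. n \<ge> 2 \<Longrightarrow> x \<in> {-1..1} \<Longrightarrow>
       (\<Sum>r\<in>jacobi_zeros \<alpha> \<beta> n. \<bar>poly (lagrange_basis (jacobi_poly \<alpha> \<beta> n) r) x\<bar>) \<le> C * rate ?\<gamma> n"
    using jacobi_lebesgue_function_bound[OF assms] by blast
  have rate: "(rate ?\<gamma> n)\<^sup>2 = (if max \<alpha> \<beta> > -1/2 then real n powr (2 * max \<alpha> \<beta> + 1) else (ln (real n))\<^sup>2)"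
    if "n \<ge> 2" for n
  proof (cases "max \<alpha> \<beta> > -1/2")
    case True
    then have e: "?\<gamma> = max \<alpha> \<beta> + 1/2" and pos: "max \<alpha> \<beta> + 1/2 > 0" by linarith+
    have "(rate ?\<gamma> n)\<^sup>2 = (real n powr (max \<alpha> \<beta> + 1/2))\<^sup>2"
      unfolding e rate_def using pos by (simp only: if_True)
    also have "\<dots> = real n powr ((max \<alpha> \<beta> + 1/2) + (max \<alpha> \<beta> + 1/2))"
      unfolding power2_eq_square powr_add ..
    also have "(max \<alpha> \<beta> + 1/2) + (max \<alpha> \<beta> + 1/2) = 2 * max \<alpha> \<beta> + 1" by simp
    finally show ?thesis using True by simp
  next
    case False
    then have e: "?\<gamma> = 0" by linarith
    show ?thesis unfolding e using False by (simp add: rate_def)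
  qed
  show ?thesis
  proof (rule bigoI[of _ "C\<^sup>2"])
    show "\<forall>\<^sub>F n in sequentially. norm (lebesgue_constant \<alpha> \<beta> n) \<le>
      C\<^sup>2 * norm (if max \<alpha> \<beta> > -1/2 then real n powr (2 * max \<alpha> \<beta> + 1) else (ln (real n))\<^sup>2)"
      using eventually_ge_at_top[of 2]
    proof eventually_elim
      case (elim n)
      have "0 \<le> lebesgue_constant \<alpha> \<beta> n \<and> lebesgue_constant \<alpha> \<beta> n \<le> (C * rate ?\<gamma> n)\<^sup>2"
        by (rule lebesgue_constant_bound[OF assms]) (use elim C(2) in auto)
      then show ?case unfolding rate[OF elim, symmetric] by (simp add: power_mult_distrib)
    qed
  qed
qed

end
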